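(* If $G$ is a connected graph of order $n$, then $\iota_{\rm g}'(G)\le \frac{1}{2}n$, with equality if and only if $G$ is isomorphic to one of the eleven graphs $F_1,\dots,F_{11}$ described below. $F_1=K_2$; $F_2=P_4$ (path on four vertices); $F_3$ is the paw (a triangle $abc$ together with a vertex $d$ adjacent only to $a$); $F_4$ is the tree obtained from the path $d_1d_2\cdots d_7$ by adding a vertex adjacent only to $d_4$; $F_5$ is obtained from a triangle $e_1e_2e_3$ and a path $e_3e_4e_5e_6e_7$ (sharing $e_3$) by adding a vertex adjacent only to $e_4$; $F_6$ is obtained from two disjoint triangles $g_1g_2g_3$ and $g_5g_6g_7$, a vertex $g_4$ adjacent to $g_3$ and $g_5$, and a further vertex adjacent only to $g_4$. For $F_7,\dots,F_{11}$, start with a $6$-cycle $c_1c_2c_3c_4c_5c_6c_1$ and two further vertices $u,v$ with the edge $uv$ ($u$ has no other neighbors), and join $v$ to cycle vertices as follows: in $F_7$, $v$ is adjacent to $c_1$ only; in $F_8$, to $c_1$ and $c_2$; in $F_9$, to $c_1$ and $c_3$; in $F_{10}$, to $c_1$ and $c_4$; in $F_{11}$, to $c_6$, $c_1$ and $c_2$.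
   Context: For a graph $G$ and $X\subseteq V(G)$, $N_G[X]$ denotes the set of vertices in $X$ or adjacent to a vertex of $X$. The isolation game on a finite graph $G$ is played by two players, Dominator and Staller, who alternately select vertices of $G$. If $X$ is the set of vertices selected so far, a vertex $x$ may be selected (is playable) only if $x$ dominates (i.e., equals or is adjacent to) some vertex belonging to a component of $G - N_G[X]$ with at least two vertices. The game ends when no playable vertex exists. Dominator aims to minimize the total number of selected vertices, Staller aims to maximize it. $\iota_{\rm g}'(G)$ denotes the number of vertices selected when Staller makes the first move and both play optimally. *)

theory Defs
  imports Complex_Main "Graph_Theory.Graph_Theory"
begin

text \<open>
  A finite simple graph is a \<^locale>\<open>pair_graph\<close>: each edge is represented by the two arcs
  joining its ends.
\<close>

definition closed_nbhd :: "'a pair_pre_digraph \<Rightarrow> 'a set \<Rightarrow> 'a set" where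
  "closed_nbhd G X = X \<union> {v \<in> pverts G. \<exists>x\<in>X. (x, v) \<in> parcs G}"

text \<open>On a symmetric digraph the strongly connected components are the usual components.\<close>

definition playable :: "'a pair_pre_digraph \<Rightarrow> 'a set \<Rightarrow> 'a \<Rightarrow> bool" where
  "playable G X x \<longleftrightarrow> x \<in> pverts G \<and>
     (\<exists>C \<in> pre_digraph.sccs (with_proj G \<restriction> (pverts G - closed_nbhd G X)).
        card (verts C) \<ge> 2 \<and> (\<exists>y \<in> verts C. y \<in> closed_nbhd G {x}))"

text \<open>A vertex already selected is never playable; this makes the game recursion terminate.\<close>

lemma playable_not_selected:
  assumes "playable G X x"
  shows "x \<notin> X"
proof
  assume "x \<in> X"
  then have "closed_nbhd G {x} \<subseteq> closed_nbhd G X"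
    by (auto simp: closed_nbhd_def)
  moreover obtain C y where
    C: "C \<in> pre_digraph.sccs (with_proj G \<restriction> (pverts G - closed_nbhd G X))"
    and "y \<in> verts C" "y \<in> closed_nbhd G {x}"
    using assms unfolding playable_def by blast
  moreover have "verts C \<subseteq> pverts G - closed_nbhd G X"
    using C by (auto simp: pre_digraph.sccs_def induced_subgraph_def subgraph_def)
  ultimately show False by blast
qed

datatype player = Dominator | Staller

text \<open>
  The number of vertices still to be selected under optimal play when \<^term>\<open>X\<close> has been
  selected and it is the turn of player \<^term>\<open>p\<close>. The value 0 on infinite graphs is a dummy,
  needed because \<^const>\<open>Min\<close> and \<^const>\<open>Max\<close> are meaningful only for finite nonempty sets.
\<close>

function remaining_moves :: "'a pair_pre_digraph \<Rightarrow> player \<Rightarrow> 'a set \<Rightarrow> nat" where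
  "remaining_moves G p X =
     (if finite (pverts G) \<and> (\<exists>x. playable G X x) then
        1 + (case p of
               Dominator \<Rightarrow> Min ((\<lambda>x. remaining_moves G Staller (insert x X)) ` {x. playable G X x})
             | Staller \<Rightarrow> Max ((\<lambda>x. remaining_moves G Dominator (insert x X)) ` {x. playable G X x}))
      else 0)"
  by pat_completeness auto
termination
proof (relation "measure (\<lambda>(G, p, X). card (pverts G - X))", goal_cases)
  case 1
  show ?case by simp
next
  case (2 G p X x)
  then have "pverts G - insert x X \<subset> pverts G - X"
    using playable_not_selected[of G X x] by (auto simp: playable_def)
  with 2 show ?case by (auto intro: psubset_card_mono)
next
  case (3 G p X x)
  then have "pverts G - insert x X \<subset> pverts G - X"
    using playable_not_selected[of G X x] by (auto simp: playable_def)
  with 3 show ?case by (auto intro: psubset_card_mono)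
qed

declare remaining_moves.simps [simp del]

definition staller_isolation_number :: "'a pair_pre_digraph \<Rightarrow> nat" where
  "staller_isolation_number G = remaining_moves G Staller {}"

definition graph_on :: "nat \<Rightarrow> (nat \<times> nat) set \<Rightarrow> nat pair_pre_digraph" where
  "graph_on n E = \<lparr>pverts = {1..n}, parcs = E \<union> E\<inverse>\<rparr>"

definition F1 :: "nat pair_pre_digraph" where
  "F1 = graph_on 2 {(1,2)}"

definition F2 :: "nat pair_pre_digraph" where
  "F2 = graph_on 4 {(1,2), (2,3), (3,4)}"

definition F3 :: "nat pair_pre_digraph" where
  "F3 = graph_on 4 {(1,2), (2,3), (3,1), (1,4)}"

text \<open>In \<open>F4\<close>, \<open>F5\<close> and \<open>F6\<close> the vertex 8 is the additional leaf attached to vertex 4.\<close>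

definition F4 :: "nat pair_pre_digraph" where
  "F4 = graph_on 8 {(1,2), (2,3), (3,4), (4,5), (5,6), (6,7), (4,8)}"

definition F5 :: "nat pair_pre_digraph" where
  "F5 = graph_on 8 {(1,2), (2,3), (3,1), (3,4), (4,5), (5,6), (6,7), (4,8)}"

definition F6 :: "nat pair_pre_digraph" where
  "F6 = graph_on 8 {(1,2), (2,3), (3,1), (5,6), (6,7), (7,5), (4,3), (4,5), (4,8)}"

text \<open>
  The 6-cycle on \<open>1, \<dots>, 6\<close> together with the edge between \<open>u = 7\<close> and \<open>v = 8\<close>, where \<open>v\<close> is
  joined to the cycle vertices in \<open>J\<close>.
\<close>

definition hexagon_graph :: "nat set \<Rightarrow> nat pair_pre_digraph" where
  "hexagon_graph J =
     graph_on 8 ({(1,2), (2,3), (3,4), (4,5), (5,6), (6,1), (7,8)} \<union> {8} \<times> J)"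

definition F7 :: "nat pair_pre_digraph" where
  "F7 = hexagon_graph {1}"

definition F8 :: "nat pair_pre_digraph" where
  "F8 = hexagon_graph {1, 2}"

definition F9 :: "nat pair_pre_digraph" where
  "F9 = hexagon_graph {1, 3}"

definition F10 :: "nat pair_pre_digraph" where
  "F10 = hexagon_graph {1, 4}"

definition F11 :: "nat pair_pre_digraph" where
  "F11 = hexagon_graph {6, 1, 2}"

end

theory Submission
  imports Defs
begin

text \<open>
  In a position call a vertex unresolved if it lies in a component of order at least two of the
  graph induced by the undominated vertices, and let \<open>U\<close> be the set of unresolved vertices. If \<open>U\<close> does
  not induce a matching, Dominator can resolve three vertices at once, and Staller always resolves
  at least one; if \<open>U\<close> induces a matching, every move resolves at least two. So at most \<open>|U|/2\<close> moves
  remain when Dominator is to move and at most \<open>(|U| + 1)/2\<close> when Staller is. Staller's first move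
  resolves at least two vertices, which gives \<open>n/2\<close>.

  In case of equality Staller opens on a leaf \<open>x\<close> with neighbor \<open>y\<close>, and \<open>H = G - {x, y}\<close> is a tight
  position for Dominator, one whose bound is attained. In it no move of Dominator resolves more than three vertices,
  and if one resolves exactly three, Staller must be able to answer by resolving exactly one,
  which leaves a tight position again. Consequently \<open>H\<close> has maximum degree at most two, a
  component with a leaf has at most three vertices, and there is no 4-cycle. The vertices
  outside \<open>H\<close> and those already dominated in \<open>H\<close> have so few neighbors among the unresolved vertices that
  trying \<open>y\<close> and suitable vertices of degree two as moves of Dominator leaves only these possibilities
  for \<open>H\<close>: empty, an edge, two components of order three, or a 6-cycle.
\<close>

section \<open>Bounds on the number of remaining moves\<close>

text \<open>A vertex lies in a component of order at least two of the subgraph induced by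
  \<open>W\<close> exactly when it has a neighbor in \<open>W\<close>. From
  \<open>playable_iff\<close> on, this local form replaces components.\<close>

definition nonisolated :: "'a pair_pre_digraph \<Rightarrow> 'a set \<Rightarrow> 'a set" where
  "nonisolated G W = {v \<in> W. \<exists>u \<in> W. (v, u) \<in> parcs G}"

definition unresolved :: "'a pair_pre_digraph \<Rightarrow> 'a set \<Rightarrow> 'a set" where
  "unresolved G X = nonisolated G (pverts G - closed_nbhd G X)"

lemma nonisolated_subset: "nonisolated G W \<subseteq> W"
  by (auto simp: nonisolated_def)

context pair_graph
begin

lemma adj_sym: "(u, v) \<in> parcs G \<Longrightarrow> (v, u) \<in> parcs G"
  by (rule graph_symmetric)

lemma adj_verts: "(u, v) \<in> parcs G \<Longrightarrow> u \<in> pverts G \<and> v \<in> pverts G"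
  using arc_fst_in_verts arc_snd_in_verts by fastforce

lemma adj_neq: "(u, v) \<in> parcs G \<Longrightarrow> u \<noteq> v"
  using pair_no_loops by fastforce

lemma closed_nbhd_single: "closed_nbhd G {x} = insert x {v. (x, v) \<in> parcs G}"
  using adj_verts by (auto simp: closed_nbhd_def)

lemma unresolved_subset: "unresolved G X \<subseteq> pverts G"
  by (auto simp: unresolved_def nonisolated_def)

lemma finite_unresolved: "finite (unresolved G X)"
  using unresolved_subset pair_finite_verts finite_subset by metis

text \<open>By symmetry the strongly connected component of \<open>y\<close> consists of all
  vertices reachable from \<open>y\<close>; it has a second vertex iff \<open>y\<close> has an
  undominated neighbor.\<close>

lemma playable_iff:
  "playable G X x \<longleftrightarrow> x \<in> pverts G \<and> closed_nbhd G {x} \<inter> unresolved G X \<noteq> {}"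
proof -
  define W where "W = pverts G - closed_nbhd G X"
  define I where "I = with_proj G \<restriction> W"
  have ind: "induced_subgraph I (with_proj G)"
    unfolding I_def by (rule induced_induce) (auto simp: W_def)
  interpret I: sym_digraph I
    using ind induced_graph_imp_symmetric[OF pair_sym_arcs ind]
    by (auto intro!: sym_digraph.intro sym_digraph_axioms.intro wf_digraphI_induced)
  have verts_I: "verts I = W" and arcs_I: "arcs_ends I \<subseteq> parcs G"
    by (auto simp: I_def arcs_ends_conv)
  have adj_I: "u \<rightarrow>\<^bsub>I\<^esub> v" if "(u, v) \<in> parcs G" "u \<in> W" "v \<in> W" for u v
    using that unfolding I_def arcs_ends_conv by (force simp: with_proj_def)
  have "(\<exists>C \<in> pre_digraph.sccs I. card (verts C) \<ge> 2 \<and> y \<in> verts C) \<longleftrightarrow> y \<in> nonisolated G W"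
    (is "?L \<longleftrightarrow> ?R") for y
  proof
    assume ?L
    then obtain C where C: "C \<in> pre_digraph.sccs I" "card (verts C) \<ge> 2" "y \<in> verts C" by auto
    then obtain y' where y': "y' \<in> verts C" "y' \<noteq> y"
      by (metis card_2_iff' obtain_subset_with_card_n subset_iff)
    have sub: "subgraph C I" "strongly_connected C"
      using C(1) by (auto simp: pre_digraph.sccs_def induced_subgraph_def)
    have "y \<rightarrow>\<^sup>*\<^bsub>C\<^esub> y'" using sub(2) C(3) y'(1) by auto
    then obtain t where t: "y \<rightarrow>\<^bsub>C\<^esub> t"
      using y'(2) by (cases rule: pre_digraph.converse_reachable_cases) auto
    then have "y \<rightarrow>\<^bsub>I\<^esub> t" using sub(1) arcs_ends_mono by blast
    then have "y \<in> W" "t \<in> W" "(y, t) \<in> parcs G"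
      using I.adj_in_verts verts_I arcs_I by auto
    then show ?R by (auto simp: nonisolated_def)
  next
    assume ?R
    then obtain u where u: "y \<in> W" "u \<in> W" "(y, u) \<in> parcs G" by (auto simp: nonisolated_def)
    let ?C = "I \<restriction> {v. y \<rightarrow>\<^sup>*\<^bsub>I\<^esub> v}"
    have "?C \<in> pre_digraph.sccs I"
      using u(1) verts_I I.induce_reachable_is_in_sccs by blast
    moreover have yu: "y \<in> verts ?C" "u \<in> verts ?C"
      using u adj_I[of y u] verts_I by auto
    moreover have "verts ?C \<subseteq> W"
      using I.reachable_in_verts(2) verts_I by auto
    then have "finite (verts ?C)"
      by (rule finite_subset) (simp add: W_def pair_finite_verts)
    then have "card (verts ?C) \<ge> 2"
      using yu adj_neq[OF u(3)] card_mono[of "verts ?C" "{y, u}"] by auto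
    ultimately show ?L by blast
  qed
  then show ?thesis
    unfolding playable_def unresolved_def I_def W_def by blast
qed

text \<open>Discarding isolated vertices before a deletion does not change which vertices are
  nonisolated after it. With \<open>playable_iff\<close>, the unresolved set alone thus determines
  how the game goes on.\<close>

lemma unresolved_insert:
  "unresolved G (insert x X) = nonisolated G (unresolved G X - closed_nbhd G {x})"
proof -
  have "closed_nbhd G (insert x X) = closed_nbhd G X \<union> closed_nbhd G {x}"
    by (auto simp: closed_nbhd_def)
  moreover have "nonisolated G (W - N) = nonisolated G (nonisolated G W - N)" for W N
    by (auto simp: nonisolated_def dest: adj_sym)
  ultimately show ?thesis by (simp add: unresolved_def Diff_eq Int_assoc)
qed

lemma unresolved_insert_subset: "unresolved G (insert x X) \<subseteq> unresolved G X - closed_nbhd G {x}"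
  unfolding unresolved_insert by (rule nonisolated_subset)

lemma unresolved_nbr: "v \<in> unresolved G X \<Longrightarrow> \<exists>u \<in> unresolved G X. (v, u) \<in> parcs G"
  using adj_sym by (auto simp: unresolved_def nonisolated_def)

lemma card_unresolved_insert_less:
  "playable G X x \<Longrightarrow> card (unresolved G (insert x X)) < card (unresolved G X)"
  unfolding playable_iff
  by (intro psubset_card_mono finite_unresolved) (use unresolved_insert_subset in blast)

lemma finite_playable: "finite {x. playable G X x}"
  by (rule finite_subset[of _ "pverts G"]) (auto simp: playable_def pair_finite_verts)

lemma unresolved_playable: "v \<in> unresolved G X \<Longrightarrow> playable G X v"
  using unresolved_subset by (auto simp: playable_iff closed_nbhd_def)

lemma ex_playable_iff: "(\<exists>x. playable G X x) \<longleftrightarrow> unresolved G X \<noteq> {}"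
  using unresolved_playable by (auto simp: playable_iff)

lemma remaining_moves_end: "unresolved G X = {} \<Longrightarrow> remaining_moves G p X = 0"
  using ex_playable_iff[of X] by (subst remaining_moves.simps) auto

lemma remaining_moves_Dominator_le:
  "playable G X x \<Longrightarrow> remaining_moves G Dominator X \<le> Suc (remaining_moves G Staller (insert x X))"
  using finite_playable[of X]
  by (subst remaining_moves.simps) (auto simp: pair_finite_verts intro!: Min_le)

lemma remaining_moves_Dominator_ex:
  "unresolved G X \<noteq> {} \<Longrightarrow> \<exists>x. playable G X x
    \<and> remaining_moves G Dominator X = Suc (remaining_moves G Staller (insert x X))"
proof -
  assume ne: "unresolved G X \<noteq> {}"
  let ?f = "\<lambda>x. remaining_moves G Staller (insert x X)"
  have "Min (?f ` {x. playable G X x}) \<in> ?f ` {x. playable G X x}"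
    using finite_playable[of X] ex_playable_iff[of X] ne by (intro Min_in) auto
  moreover have "remaining_moves G Dominator X = Suc (Min (?f ` {x. playable G X x}))"
    using ex_playable_iff[of X] ne
    by (subst remaining_moves.simps) (simp add: pair_finite_verts)
  ultimately show ?thesis by auto
qed

lemma remaining_moves_Staller_ge:
  "playable G X x \<Longrightarrow> Suc (remaining_moves G Dominator (insert x X)) \<le> remaining_moves G Staller X"
  using finite_playable[of X]
  by (subst (2) remaining_moves.simps) (auto simp: pair_finite_verts intro!: Max_ge)

lemma remaining_moves_Staller_ex:
  "unresolved G X \<noteq> {} \<Longrightarrow> \<exists>x. playable G X x
    \<and> remaining_moves G Staller X = Suc (remaining_moves G Dominator (insert x X))"
proof -
  assume ne: "unresolved G X \<noteq> {}"
  let ?f = "\<lambda>x. remaining_moves G Dominator (insert x X)"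
  have "Max (?f ` {x. playable G X x}) \<in> ?f ` {x. playable G X x}"
    using finite_playable[of X] ex_playable_iff[of X] ne by (intro Max_in) auto
  moreover have "remaining_moves G Staller X = Suc (Max (?f ` {x. playable G X x}))"
    using ex_playable_iff[of X] ne
    by (subst remaining_moves.simps) (simp add: pair_finite_verts)
  ultimately show ?thesis by auto
qed

lemma card_le_minus: "\<lbrakk>A \<subseteq> B - S; S \<subseteq> B; finite B\<rbrakk> \<Longrightarrow> card A + card S \<le> card B"
  by (metis card_Diff_subset card_mono finite_Diff finite_subset le_diff_conv2)

text \<open>The hypothesis says that the unresolved vertices induce a matching. A move dominating
  one end of an edge also resolves the other end, and a matching remains, so every move of either
  player uses up two vertices.\<close>

lemma remaining_moves_matching:
  assumes "\<And>v u w. \<lbrakk>v \<in> unresolved G X; u \<in> unresolved G X; w \<in> unresolved G X;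
      (v, u) \<in> parcs G; (v, w) \<in> parcs G\<rbrakk> \<Longrightarrow> u = w"
  shows "2 * remaining_moves G p X \<le> card (unresolved G X)"
  using assms
proof (induction "card (unresolved G X)" arbitrary: X p rule: less_induct)
  case less
  show ?case
  proof (cases "unresolved G X = {}")
    case True
    then show ?thesis by (simp add: remaining_moves_end)
  next
    case False
    have drop: "2 * Suc (remaining_moves G q (insert x X)) \<le> card (unresolved G X)"
      if x: "playable G X x" for x q
    proof -
      obtain v where v: "v \<in> unresolved G X" "v \<in> closed_nbhd G {x}"
        using x by (auto simp: playable_iff)
      obtain u where u: "u \<in> unresolved G X" "(v, u) \<in> parcs G"
        using unresolved_nbr[OF v(1)] by blast
      have "u \<notin> unresolved G (insert x X)"
        using less.prems[of u _ v] u v unresolved_insert_subset[of x X] adj_sym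
          unresolved_nbr[of u "insert x X"] by blast
      then have "unresolved G (insert x X) \<subseteq> unresolved G X - {u, v}"
        using v unresolved_insert_subset by blast
      then have "card (unresolved G (insert x X)) + card {u, v} \<le> card (unresolved G X)"
        using u v finite_unresolved by (intro card_le_minus) auto
      moreover have "2 * remaining_moves G q (insert x X) \<le> card (unresolved G (insert x X))"
        using less.hyps[OF card_unresolved_insert_less[OF x]] less.prems
          unresolved_insert_subset[of x X] by blast
      ultimately show ?thesis using adj_neq[OF u(2)] by auto
    qed
    show ?thesis
    proof (cases p)
      case Dominator
      then show ?thesis using drop remaining_moves_Dominator_ex[OF False] by metis
    next
      case Staller
      then show ?thesis using drop remaining_moves_Staller_ex[OF False] by metis
    qed
  qed
qed

text \<open>If Dominator can resolve three vertices, they pay 2 for his move and 1 for the surplus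
  in Staller's bound. If no unresolved vertex has two unresolved neighbors, the matching case
  applies.\<close>

theorem remaining_moves_bounds:
  "2 * remaining_moves G Dominator X \<le> card (unresolved G X)
    \<and> 2 * remaining_moves G Staller X \<le> Suc (card (unresolved G X))"
proof (induction "card (unresolved G X)" arbitrary: X rule: less_induct)
  case less
  show ?case
  proof (cases "unresolved G X = {}")
    case True
    then show ?thesis by (simp add: remaining_moves_end)
  next
    case False
    have IH: "2 * remaining_moves G Dominator (insert x X) \<le> card (unresolved G (insert x X))"
      "2 * remaining_moves G Staller (insert x X) \<le> Suc (card (unresolved G (insert x X)))"
      if "playable G X x" for x
      using less.hyps[OF card_unresolved_insert_less[OF that]] by auto
    have "2 * remaining_moves G Dominator X \<le> card (unresolved G X)"
    proof (cases "\<exists>z a b. z \<in> unresolved G X \<and> a \<in> unresolved G X \<and> b \<in> unresolved G X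
        \<and> a \<noteq> b \<and> (z, a) \<in> parcs G \<and> (z, b) \<in> parcs G")
      case True
      then obtain z a b where z: "z \<in> unresolved G X" "a \<in> unresolved G X" "b \<in> unresolved G X"
        "a \<noteq> b" "(z, a) \<in> parcs G" "(z, b) \<in> parcs G" by blast
      then have pz: "playable G X z" by (intro unresolved_playable)
      have "unresolved G (insert z X) \<subseteq> unresolved G X - {z, a, b}"
        using unresolved_insert_subset[of z X] z by (auto simp: closed_nbhd_single)
      then have "card (unresolved G (insert z X)) + card {z, a, b} \<le> card (unresolved G X)"
        using z finite_unresolved by (intro card_le_minus) auto
      moreover have "card {z, a, b} = 3" using z adj_neq by auto
      ultimately show ?thesis
        using IH(2)[OF pz] remaining_moves_Dominator_le[OF pz] by linarith
    next
      case False
      then show ?thesis by (intro remaining_moves_matching) blast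
    qed
    moreover obtain x where x: "playable G X x"
      "remaining_moves G Staller X = Suc (remaining_moves G Dominator (insert x X))"
      using remaining_moves_Staller_ex[OF False] by blast
    then have "2 * remaining_moves G Staller X \<le> Suc (card (unresolved G X))"
      using IH(1)[OF x(1)] card_unresolved_insert_less[OF x(1)] by linarith
    ultimately show ?thesis by blast
  qed
qed

end

section \<open>Tight positions\<close>

context pair_graph
begin

abbreviation adj (infix \<open>\<sim>\<close> 50) where "u \<sim> v \<equiv> (u, v) \<in> parcs G"

text \<open>
  Positions attaining the bounds of \<open>remaining_moves_bounds\<close>. The number of remaining moves depends
  only on the unresolved vertices, so the position \<open>X\<close> itself can be forgotten.
\<close>

definition D_tight :: "'a set \<Rightarrow> bool" where
  "D_tight U \<longleftrightarrow> (\<exists>X. unresolved G X = U \<and> 2 * remaining_moves G Dominator X = card U)"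

definition S_tight :: "'a set \<Rightarrow> bool" where
  "S_tight U \<longleftrightarrow> (\<exists>X. unresolved G X = U \<and> 2 * remaining_moves G Staller X = Suc (card U))"

lemma D_tight_nbr: "\<lbrakk>D_tight U; v \<in> U\<rbrakk> \<Longrightarrow> \<exists>u \<in> U. v \<sim> u"
  using unresolved_nbr by (auto simp: D_tight_def)

lemma S_tight_nbr: "\<lbrakk>S_tight U; v \<in> U\<rbrakk> \<Longrightarrow> \<exists>u \<in> U. v \<sim> u"
  using unresolved_nbr by (auto simp: S_tight_def)

text \<open>\<open>S\<close> is any set of vertices resolved by the move \<open>z\<close>. Staller's
  bound leaves room for three of them; if \<open>S\<close> has three, all estimates are equalities,
  so nothing else is resolved and Staller's position is tight.\<close>

lemma D_tight_move:
  assumes "D_tight U" and "z \<in> pverts G" and "S \<subseteq> U"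
    and "S \<inter> nonisolated G (U - closed_nbhd G {z}) = {}"
  shows "card S \<le> 3
    \<and> (card S = 3 \<longrightarrow> nonisolated G (U - closed_nbhd G {z}) = U - S \<and> S_tight (U - S))"
proof -
  obtain X where X: "unresolved G X = U" "2 * remaining_moves G Dominator X = card U"
    using assms(1) by (auto simp: D_tight_def)
  have fin: "finite U" using X(1) finite_unresolved by blast
  let ?U = "nonisolated G (U - closed_nbhd G {z})"
  have U': "unresolved G (insert z X) = ?U"
    using X(1) unresolved_insert by simp
  have sub: "?U \<subseteq> U - S"
    using assms(4) nonisolated_subset[of G "U - closed_nbhd G {z}"] by blast
  show ?thesis
  proof (cases "playable G X z")
    case True
    have le: "card ?U + card S \<le> card U"
      using card_le_minus[OF sub assms(3) fin] .
    have d: "card U \<le> 2 * Suc (remaining_moves G Staller (insert z X))"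
      using remaining_moves_Dominator_le[OF True] unfolding X(2)[symmetric] by simp
    have s: "2 * remaining_moves G Staller (insert z X) \<le> Suc (card ?U)"
      using remaining_moves_bounds[of "insert z X"] U' by simp
    have "?U = U - S \<and> S_tight (U - S)" if "card S = 3"
    proof -
      have eq: "?U = U - S"
      proof (rule card_subset_eq[OF _ sub])
        have "card (U - S) = card U - card S"
          using assms(3) fin finite_subset by (intro card_Diff_subset) auto
        then show "card ?U = card (U - S)" using le d s that by simp
      qed (use fin in simp)
      moreover have "2 * remaining_moves G Staller (insert z X) = Suc (card ?U)"
        using le d s that by simp
      ultimately show ?thesis using U' unfolding S_tight_def by metis
    qed
    then show ?thesis using le d s by auto
  next
    case False
    then have "U - closed_nbhd G {z} = U"
      using X(1) assms(2) by (auto simp: playable_iff)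
    moreover have "nonisolated G U = U"
      using D_tight_nbr[OF assms(1)] by (force simp: nonisolated_def)
    ultimately have "S = {}" using assms(3,4) by auto
    then show ?thesis by simp
  qed
qed

text \<open>Tightness forces an optimal move of Staller to resolve a single vertex \<open>t\<close>.
  The move \<open>w\<close> lies outside \<open>U\<close>, since otherwise it would resolve itself
  and a neighbor.\<close>

lemma S_tight_move:
  assumes "S_tight U"
  shows "\<exists>w \<in> pverts G - U. \<exists>t \<in> U. w \<sim> t \<and> (\<forall>u \<in> U. w \<sim> u \<longrightarrow> u = t) \<and> D_tight (U - {t})"
proof -
  obtain X where X: "unresolved G X = U" "2 * remaining_moves G Staller X = Suc (card U)"
    using assms(1) by (auto simp: S_tight_def)
  have fin: "finite U" using X(1) finite_unresolved by blast
  have "unresolved G X \<noteq> {}"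
    using X remaining_moves_end[of X Staller] by auto
  then obtain w where w: "playable G X w"
    "remaining_moves G Staller X = Suc (remaining_moves G Dominator (insert w X))"
    using remaining_moves_Staller_ex by blast
  let ?U = "unresolved G (insert w X)"
  obtain t where t: "t \<in> U" "t \<in> closed_nbhd G {w}"
    using w(1) X(1) by (auto simp: playable_iff)
  have sub: "?U \<subseteq> U - closed_nbhd G {w}"
    using unresolved_insert_subset X(1) by blast
  have d: "Suc (card ?U) = card U \<and> 2 * remaining_moves G Dominator (insert w X) = card ?U"
    using remaining_moves_bounds[of "insert w X"] X w card_unresolved_insert_less[OF w(1)] by auto
  then have eq: "?U = U - {t}"
    using sub t fin by (intro card_subset_eq) auto
  then have only: "u = t" if "u \<in> U" "u \<in> closed_nbhd G {w}" for u
    using sub that by blast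
  have "w \<notin> U"
  proof
    assume "w \<in> U"
    moreover obtain u where "u \<in> U" "w \<sim> u"
      using calculation unresolved_nbr X(1) by blast
    ultimately show False
      using only adj_neq by (auto simp: closed_nbhd_single)
  qed
  moreover have "D_tight (U - {t})"
    using d eq unfolding D_tight_def by metis
  moreover have "w \<sim> t"
    using t calculation(1) by (auto simp: closed_nbhd_single)
  moreover have "\<forall>u \<in> U. w \<sim> u \<longrightarrow> u = t"
    using only by (auto simp: closed_nbhd_single)
  moreover have "w \<in> pverts G"
    using w(1) by (simp add: playable_def)
  ultimately show ?thesis using t(1) by blast
qed

text \<open>Playing \<open>z\<close> resolves \<open>z\<close> and all its neighbors in
  \<open>U\<close>, and a tight position allows at most three resolved vertices.\<close>

lemma D_tight_deg2:
  assumes U: "D_tight U" "z \<in> U" "a \<in> U" "b \<in> U" and z: "a \<noteq> b" "z \<sim> a" "z \<sim> b"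
  shows "S_tight (U - {z, a, b})" and "\<And>u. \<lbrakk>u \<in> U; z \<sim> u\<rbrakk> \<Longrightarrow> u = a \<or> u = b"
proof -
  have zV: "z \<in> pverts G" using adj_verts z by blast
  have *: "S \<inter> nonisolated G (U - closed_nbhd G {z}) = {}" if "S \<subseteq> insert z {u. z \<sim> u}" for S
    using that by (auto simp: nonisolated_def closed_nbhd_single)
  have "card {z, a, b} = 3" using z adj_neq by auto
  then show "S_tight (U - {z, a, b})"
    using D_tight_move[OF U(1) zV _ *[of "{z, a, b}"]] U z by auto
  show "u = a \<or> u = b" if "u \<in> U" "z \<sim> u" for u
  proof (rule ccontr)
    assume "\<not> ?thesis"
    then have "card {z, a, b, u} = 4" using z that adj_neq[of z] by auto
    moreover have "card {z, a, b, u} \<le> 3"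
      using D_tight_move[OF U(1) zV _ *[of "{z, a, b, u}"]] U z that by auto
    ultimately show False by simp
  qed
qed

text \<open>If \<open>t\<close> differed from \<open>q\<close>, playing \<open>r\<close> would
  resolve \<open>r\<close>, \<open>q\<close>, \<open>t\<close> and isolate the leaf \<open>p\<close>
  as a fourth vertex. Hence a component with a leaf has at most three vertices.\<close>

lemma D_tight_leaf:
  assumes U: "D_tight U" "p \<in> U" "q \<in> U" "r \<in> U" "t \<in> U"
    and p: "\<And>u. \<lbrakk>u \<in> U; p \<sim> u\<rbrakk> \<Longrightarrow> u = q" and r: "q \<sim> r" "r \<noteq> p" "r \<sim> t"
  shows "t = q"
proof (rule ccontr)
  assume "t \<noteq> q"
  moreover have "t \<noteq> p" using p[of r] U r adj_sym adj_neq by blast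
  moreover have "r \<sim> q" using r(1) by (rule adj_sym)
  moreover have "p \<noteq> q" using p[of q] p U D_tight_nbr[OF U(1,2)] adj_neq by blast
  ultimately have "S_tight (U - {r, q, t})" "p \<in> U - {r, q, t}"
    using D_tight_deg2(1)[of U r q t] U r by blast+
  then have "\<exists>u \<in> U - {r, q, t}. p \<sim> u"
    by (rule S_tight_nbr)
  then show False using p by blast
qed

end

text \<open>Staller has opened on the leaf \<open>x\<close> with neighbor \<open>y\<close>. The
  assumption \<open>closed_meets\<close> is what connectedness of \<open>G\<close> leaves: every
  nonempty union of components of the subgraph induced by \<open>H\<close> contains a neighbor of
  \<open>y\<close>.\<close>

locale tight_leaf = pair_graph G for G :: "'a pair_pre_digraph" +
  fixes x y :: 'a and H :: "'a set"
  assumes verts: "pverts G = insert x (insert y H)"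
    and not_in_H: "x \<notin> H" "y \<notin> H"
    and x_adj: "(x, v) \<in> parcs G \<longleftrightarrow> v = y"
    and tight: "D_tight H"
    and closed_meets: "\<lbrakk>S \<subseteq> H; S \<noteq> {}; \<And>u v. \<lbrakk>u \<in> S; v \<in> H; (u, v) \<in> parcs G\<rbrakk> \<Longrightarrow> v \<in> S\<rbrakk>
      \<Longrightarrow> \<exists>b \<in> S. (y, b) \<in> parcs G"
begin

lemma H_nbr: "v \<in> H \<Longrightarrow> \<exists>u \<in> H. v \<sim> u"
  using D_tight_nbr[OF tight] .

text \<open>The move \<open>y\<close> resolves its neighbors and every vertex whose neighbors in
  \<open>U\<close> are all adjacent to \<open>y\<close>. If \<open>S\<close> has three such
  vertices, nothing else is resolved, so no neighbor of \<open>y\<close> remains.\<close>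

lemma y_move:
  assumes "D_tight U" and "S \<subseteq> U"
    and lost: "\<forall>v \<in> S. y \<sim> v \<or> (\<forall>u \<in> U. v \<sim> u \<longrightarrow> y \<sim> u)"
  shows "card S \<le> 3" and "card S = 3 \<Longrightarrow> S_tight (U - S)"
    and "\<lbrakk>card S = 3; v \<in> U - S\<rbrakk> \<Longrightarrow> \<not> y \<sim> v"
proof -
  have "S \<inter> nonisolated G (U - closed_nbhd G {y}) = {}"
    using lost by (auto simp: nonisolated_def closed_nbhd_single)
  moreover have "nonisolated G (U - closed_nbhd G {y}) \<inter> {v. y \<sim> v} = {}"
    by (auto simp: nonisolated_def closed_nbhd_single)
  ultimately show "card S \<le> 3" and "card S = 3 \<Longrightarrow> S_tight (U - S)"
    and "\<lbrakk>card S = 3; v \<in> U - S\<rbrakk> \<Longrightarrow> \<not> y \<sim> v"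
    using D_tight_move[OF assms(1) _ assms(2), of y] verts by auto
qed

text \<open>\<open>x\<close> is excluded as Staller's answer because its only neighbor
  \<open>y\<close> lies outside \<open>H\<close>.\<close>

lemma S_move:
  assumes "S_tight U" and "U \<subseteq> H"
  shows "\<exists>w \<in> insert y (H - U). \<exists>t \<in> U.
    w \<sim> t \<and> (\<forall>u \<in> U. w \<sim> u \<longrightarrow> u = t) \<and> D_tight (U - {t})"
proof -
  obtain w t where w: "w \<in> pverts G - U" "t \<in> U" "w \<sim> t" "\<forall>u \<in> U. w \<sim> u \<longrightarrow> u = t" "D_tight (U - {t})"
    using S_tight_move[OF assms(1)] by blast
  moreover have "w \<noteq> x" using w(2,3) x_adj not_in_H assms(2) by auto
  ultimately show ?thesis using verts by blast
qed

lemma complement_meets: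
  assumes "H - K \<noteq> {}" and "\<And>u v. \<lbrakk>u \<in> K; v \<in> H; u \<sim> v\<rbrakk> \<Longrightarrow> v \<in> K"
  shows "\<exists>b \<in> H - K. y \<sim> b"
  by (rule closed_meets) (use assms adj_sym in blast)+

text \<open>Otherwise \<open>y\<close> has a neighbor \<open>b\<close> elsewhere in
  \<open>H\<close>, and playing \<open>y\<close> resolves exactly \<open>p\<close>,
  \<open>q\<close>, \<open>b\<close>. Staller can then only answer with \<open>b\<close>, which
  makes \<open>b\<close> a leaf at some \<open>t\<close>; resolving \<open>t\<close> isolates
  another neighbor \<open>s\<close> of \<open>t\<close>, against tightness.\<close>

lemma isolated_edge:
  assumes "p \<in> H" "q \<in> H" "p \<sim> q"
    and p: "\<And>u. \<lbrakk>u \<in> H; p \<sim> u\<rbrakk> \<Longrightarrow> u = q" and q: "\<And>u. \<lbrakk>u \<in> H; q \<sim> u\<rbrakk> \<Longrightarrow> u = p"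
  shows "H = {p, q}"
proof (rule ccontr)
  assume "H \<noteq> {p, q}"
  then obtain b where b: "b \<in> H" "b \<noteq> p" "b \<noteq> q" "y \<sim> b"
    using closed_meets[of "H - {p, q}"] assms adj_sym by blast
  have "y \<sim> p \<or> y \<sim> q"
    using closed_meets[of "{p, q}"] assms by blast
  then have lost: "\<forall>v \<in> {p, q, b}. y \<sim> v \<or> (\<forall>u \<in> H. v \<sim> u \<longrightarrow> y \<sim> u)"
    using b p q by blast
  have sub: "{p, q, b} \<subseteq> H" and card: "card {p, q, b} = 3"
    using assms(1,2) b adj_neq[OF assms(3)] by auto
  note move = y_move[OF tight sub lost]
  obtain w t where w: "w \<in> insert y {p, q, b}" "t \<in> H - {p, q, b}" "w \<sim> t"
    "\<forall>u \<in> H - {p, q, b}. w \<sim> u \<longrightarrow> u = t" "D_tight (H - {p, q, b} - {t})"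
    using S_move[OF move(2)[OF card]] sub by blast
  \<comment> \<open>\<open>p\<close> and \<open>q\<close> have no neighbors in the rest, and
    \<open>y\<close> has none left once it has resolved three vertices.\<close>
  have "w = b"
    using w(1-3) move(3)[OF card w(2)] p q by blast
  then have bt: "b \<sim> t" and bonly: "\<And>u. \<lbrakk>u \<in> H; b \<sim> u\<rbrakk> \<Longrightarrow> u = t"
    using w p q adj_sym adj_neq b by blast+
  obtain s where s: "s \<in> H - {p, q, b}" "t \<sim> s"
    using S_tight_nbr[OF move(2)[OF card] w(2)] by blast
  have "u = t" if "u \<in> H" "s \<sim> u" for u
    using D_tight_leaf[OF tight, of b t s u] b bonly w(2) s that by blast
  moreover have "\<exists>u \<in> H - {p, q, b} - {t}. s \<sim> u"
    using s adj_neq by (intro D_tight_nbr[OF w(5)]) blast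
  ultimately show False by blast
qed

text \<open>Playing \<open>b\<close> resolves \<open>a\<close>, \<open>b\<close>, \<open>c\<close>.
  The rest is tight for Staller, so \<open>d\<close> needs a neighbor besides \<open>a\<close> and
  \<open>c\<close>, contradicting maximum degree two.\<close>

lemma no_4_cycle:
  assumes "a \<in> H" "b \<in> H" "c \<in> H" "d \<in> H" "a \<noteq> c" "b \<noteq> d" "a \<sim> b" "b \<sim> c" "c \<sim> d" "d \<sim> a"
  shows False
proof -
  have "S_tight (H - {b, a, c})"
    using D_tight_deg2(1)[OF tight, of b a c] assms adj_sym by blast
  moreover have "d \<in> H - {b, a, c}" using assms adj_neq by blast
  ultimately obtain u where "u \<in> H - {b, a, c}" "d \<sim> u"
    using S_tight_nbr by blast
  then show False
    using D_tight_deg2(2)[OF tight, of d a c u] assms adj_sym by blast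
qed

text \<open>Without \<open>c\<close>, its neighbor \<open>a\<close> is a leaf at some
  \<open>t\<close>. The leaf lemma in \<open>S - {c}\<close> then forces a 4-cycle through
  \<open>c\<close> or a component of \<open>H\<close> with a leaf and at least four
  vertices.\<close>

lemma cut_cycle:
  assumes S: "S \<subseteq> H" "\<And>u v. \<lbrakk>u \<in> S; v \<in> H; u \<sim> v\<rbrakk> \<Longrightarrow> v \<in> S"
    and c: "c \<in> S" "a \<in> H" "a' \<in> H" "c \<sim> a" "c \<sim> a'" "a \<noteq> a'" "\<not> a \<sim> a'"
    and cut: "D_tight (S - {c})"
  shows False
proof -
  have c_only: "u = a \<or> u = a'" if "u \<in> H" "c \<sim> u" for u
    using D_tight_deg2(2)[OF tight, of c a a' u] S c that by blast
  have aU: "a \<in> S - {c}" "a' \<in> S - {c}"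
    using S(2)[of c] c adj_neq by blast+
  obtain t where t: "t \<in> S - {c}" "a \<sim> t"
    using D_tight_nbr[OF cut aU(1)] by blast
  have "t \<noteq> a'" using t c by blast
  have a_only: "u = c \<or> u = t" if "u \<in> H" "a \<sim> u" for u
    using D_tight_deg2(2)[OF tight, of a c t u] S c t that adj_sym by blast
  show False
  proof (cases "\<exists>s \<in> S - {c}. t \<sim> s \<and> s \<noteq> a")
    case True
    then obtain s where s: "s \<in> S - {c}" "t \<sim> s" "s \<noteq> a" by blast
    have s_only: "u = t" if "u \<in> S - {c}" "s \<sim> u" for u
      using D_tight_leaf[OF cut, of a t s u] aU t s that a_only S by blast
    show False
    proof (cases "s = a'")
      case True
      then show False
        using no_4_cycle[of c a t a'] c t s S adj_sym by blast
    next
      case False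
      then have "u = t" if "u \<in> H" "s \<sim> u" for u
        using s_only[of u] that S(2)[of s u] s c_only[of s] S(1) adj_sym by blast
      then show False
        using D_tight_leaf[OF tight, of s t a c] s t c S adj_sym by blast
    qed
  next
    case False
    then have "u = a" if "u \<in> H" "t \<sim> u" for u
      using that S t c_only[of t] adj_sym \<open>t \<noteq> a'\<close> adj_neq[OF t(2)] by blast
    then show False
      using D_tight_leaf[OF tight, of t a c a'] t c S adj_sym by blast
  qed
qed

text \<open>Playing \<open>z\<close> resolves a component of order three; Staller can only answer
  with \<open>y\<close>, which therefore has a single neighbor \<open>c\<close> outside it. Every
  component contains a neighbor of \<open>y\<close>, so the rest is the component of
  \<open>c\<close>. Whether \<open>e\<close>, \<open>g\<close> and \<open>c\<close>,
  \<open>s\<close> are adjacent stays open.\<close>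

lemma closed_triple:
  assumes z: "z \<in> H" "a \<in> H" "b \<in> H" "a \<noteq> b" "z \<sim> a" "z \<sim> b"
    and closed: "\<And>u v. \<lbrakk>u \<in> {z, a, b}; v \<in> H; u \<sim> v\<rbrakk> \<Longrightarrow> v \<in> {z, a, b}"
  shows "\<exists>e f g c t s. distinct [e, f, g, c, t, s] \<and> H = {e, f, g, c, t, s}
    \<and> e \<sim> f \<and> f \<sim> g \<and> y \<sim> e \<and> \<not> y \<sim> f \<and> \<not> y \<sim> g
    \<and> c \<sim> t \<and> t \<sim> s \<and> y \<sim> c \<and> \<not> y \<sim> t \<and> \<not> y \<sim> s
    \<and> (\<forall>u \<in> {e, f, g}. \<forall>v \<in> {c, t, s}. \<not> u \<sim> v)"
proof -
  let ?U = "H - {z, a, b}"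
  have zab: "z \<noteq> a" "z \<noteq> b" using z adj_neq by auto
  have tU: "S_tight ?U"
    using D_tight_deg2(1)[OF tight] z by blast
  obtain w c where w: "w \<in> insert y {z, a, b}" "c \<in> ?U" "w \<sim> c"
    "\<forall>u \<in> ?U. w \<sim> u \<longrightarrow> u = c" "D_tight (?U - {c})"
    using S_move[OF tU] z by blast
  then have "w = y" using closed[of w c] by blast
  with w have c: "c \<in> ?U" "y \<sim> c" "\<And>u. \<lbrakk>u \<in> ?U; y \<sim> u\<rbrakk> \<Longrightarrow> u = c" and cut: "D_tight (?U - {c})"
    by blast+
  have U_closed: "v \<in> ?U" if "u \<in> ?U" "v \<in> H" "u \<sim> v" for u v
    using that closed[of v u] adj_sym by blast
  obtain t where t: "t \<in> ?U" "c \<sim> t"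
    using S_tight_nbr[OF tU c(1)] by blast
  \<comment> \<open>The component of \<open>c\<close> is a triangle if \<open>c\<close> has two
    neighbors, by \<open>cut_cycle\<close>, and otherwise a path on three vertices with end
    \<open>c\<close>.\<close>
  have "\<exists>t s. t \<in> ?U \<and> s \<in> ?U \<and> c \<sim> t \<and> t \<sim> s \<and> s \<noteq> c
    \<and> (\<forall>u \<in> {c, t, s}. \<forall>v \<in> H. u \<sim> v \<longrightarrow> v \<in> {c, t, s})"
  proof (cases "\<exists>s \<in> H. c \<sim> s \<and> s \<noteq> t")
    case True
    then obtain s where s: "s \<in> ?U" "c \<sim> s" "s \<noteq> t" using U_closed c by blast
    have "t \<sim> s"
      using cut_cycle[of ?U c t s] U_closed c t s cut by blast
    have "t \<sim> c" "s \<sim> c" "s \<sim> t" "c \<noteq> s"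
      using t(2) s(2) \<open>t \<sim> s\<close> adj_sym adj_neq by blast+
    then have "\<forall>u \<in> {c, t, s}. \<forall>v \<in> H. u \<sim> v \<longrightarrow> v \<in> {c, t, s}"
      using D_tight_deg2(2)[OF tight, of c t s] D_tight_deg2(2)[OF tight, of t c s]
        D_tight_deg2(2)[OF tight, of s c t] c(1) t s \<open>t \<sim> s\<close> adj_neq[of c t] by blast
    then show ?thesis using t s \<open>t \<sim> s\<close> adj_neq by blast
  next
    case False
    then have c_only: "u = t" if "u \<in> H" "c \<sim> u" for u using that by blast
    have "\<exists>s \<in> H. t \<sim> s \<and> s \<noteq> c"
    proof (rule ccontr)
      assume "\<not> ?thesis"
      then have "H = {c, t}"
        using isolated_edge[of c t] c_only c(1) t by blast
      then show False using z(1) c(1) t(1) by blast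
    qed
    then obtain s where s: "s \<in> ?U" "t \<sim> s" "s \<noteq> c"
      using U_closed[OF t(1)] by blast
    have "\<forall>v \<in> H. s \<sim> v \<longrightarrow> v = t"
      using D_tight_leaf[OF tight, of c t s] c_only c t s by blast
    moreover have "\<forall>v \<in> H. t \<sim> v \<longrightarrow> v = c \<or> v = s"
      using D_tight_deg2(2)[OF tight, of t c s] c t s adj_sym by blast
    ultimately show ?thesis using t s c_only by blast
  qed
  then obtain t s where ts: "t \<in> ?U" "s \<in> ?U" "c \<sim> t" "t \<sim> s" "s \<noteq> c"
    and cts: "\<And>u v. \<lbrakk>u \<in> {c, t, s}; v \<in> H; u \<sim> v\<rbrakk> \<Longrightarrow> v \<in> {c, t, s}"
    by blast
  have neq: "t \<noteq> c" "t \<noteq> s" using ts adj_neq by auto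
  have H: "H = {z, a, b, c, t, s}"
  proof (rule ccontr)
    assume "H \<noteq> {z, a, b, c, t, s}"
    then have "H - {z, a, b, c, t, s} \<noteq> {}" using z c ts by blast
    then obtain b' where "b' \<in> H - {z, a, b, c, t, s}" "y \<sim> b'"
      using complement_meets[of "{z, a, b, c, t, s}"] closed cts by blast
    then show False using c(3) by blast
  qed
  obtain e where e: "e \<in> {z, a, b}" "y \<sim> e"
    using closed_meets[of "{z, a, b}"] closed z by blast
  have card4: "card {z, a, b, c} = 4" using zab z(4) c(1) by auto
  \<comment> \<open>With two neighbors among \<open>z\<close>, \<open>a\<close>, \<open>b\<close>,
    the move \<open>y\<close> would resolve all three and \<open>c\<close>, one more than tightness
    allows.\<close>
  have e_only: "u = e" if u: "u \<in> {z, a, b}" "y \<sim> u" for u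
  proof (rule ccontr)
    assume "u \<noteq> e"
    moreover have "\<not> v \<sim> v" for v using adj_neq by blast
    moreover have "v \<in> {z, a, b} - {u, e} \<Longrightarrow> w \<in> H \<Longrightarrow> v \<sim> w \<Longrightarrow> w = u \<or> w = e" for v w
      using closed[of v w] e(1) u(1) calculation zab z(4) by auto
    ultimately have "\<forall>v \<in> {z, a, b, c}. y \<sim> v \<or> (\<forall>u \<in> H. v \<sim> u \<longrightarrow> y \<sim> u)"
      using e(2) u(2) c(2) by blast
    then have "card {z, a, b, c} \<le> 3"
      by (intro y_move(1)[OF tight]) (use z(1-3) c(1) in auto)
    then show False using card4 by simp
  qed
  \<comment> \<open>If \<open>z\<close> were the middle of a path, \<open>y\<close> would isolate
    both ends: again four resolved vertices. So in a path, \<open>e\<close> is an end.\<close>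
  have "a \<sim> b" if "e = z"
  proof (rule ccontr)
    assume nab: "\<not> a \<sim> b"
    moreover have "\<not> b \<sim> a" using nab adj_sym by blast
    moreover have "\<not> v \<sim> v" for v using adj_neq by blast
    ultimately have "\<forall>u \<in> H. a \<sim> u \<longrightarrow> u = z" "\<forall>u \<in> H. b \<sim> u \<longrightarrow> u = z"
      using closed[of a] closed[of b] by blast+
    then have "\<forall>v \<in> {z, a, b, c}. y \<sim> v \<or> (\<forall>u \<in> H. v \<sim> u \<longrightarrow> y \<sim> u)"
      using e(2) c(2) \<open>e = z\<close> by blast
    then have "card {z, a, b, c} \<le> 3"
      by (intro y_move(1)[OF tight]) (use z(1-3) c(1) in auto)
    then show False using card4 by simp
  qed
  then have "\<exists>f g. distinct [e, f, g] \<and> {e, f, g} = {z, a, b} \<and> e \<sim> f \<and> f \<sim> g"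
  proof -
    have sym: "a \<sim> z" "b \<sim> z" using z(5,6) adj_sym by blast+
    consider "e = z" | "e = a" | "e = b" using e(1) by blast
    then show ?thesis
    proof cases
      case 1
      then show ?thesis
        using \<open>e = z \<Longrightarrow> a \<sim> b\<close> z(4,5) zab by (intro exI[of _ a] exI[of _ b]) auto
    next
      case 2
      then show ?thesis
        using sym z(4,6) zab by (intro exI[of _ z] exI[of _ b]) auto
    next
      case 3
      then show ?thesis
        using sym z(4,5) zab by (intro exI[of _ z] exI[of _ a]) auto
    qed
  qed
  then obtain f g where fg: "distinct [e, f, g]" "{e, f, g} = {z, a, b}" "e \<sim> f" "f \<sim> g" by blast
  have "distinct [e, f, g, c, t, s]"
  proof -
    have "{e, f, g} \<inter> {c, t, s} = {}" using fg(2) c ts by blast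
    then show ?thesis using fg(1) ts neq by auto
  qed
  moreover have "H = {e, f, g, c, t, s}" using H fg(2) by blast
  moreover have "\<not> y \<sim> f" "\<not> y \<sim> g" using e_only[of f] e_only[of g] fg by auto
  moreover have "\<not> y \<sim> t" "\<not> y \<sim> s" using c(3) ts neq by blast+
  moreover have "\<forall>u \<in> {e, f, g}. \<forall>v \<in> {c, t, s}. \<not> u \<sim> v"
    using closed fg(2) c ts by blast
  ultimately show ?thesis
    using e(2) fg ts c(2) by blast
qed

end

section \<open>The 2-regular triangle-free case\<close>

text \<open>All neighborhoods are taken in \<open>H\<close>, so the 6-cycle is induced and a whole
  component; that it exhausts \<open>H\<close> is proved separately.\<close>

definition (in pair_graph) hexagon :: "'a set \<Rightarrow> 'a \<Rightarrow> 'a \<Rightarrow> 'a \<Rightarrow> 'a \<Rightarrow> 'a \<Rightarrow> 'a \<Rightarrow> bool" where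
  "hexagon H c0 c1 c2 c3 c4 c5 \<longleftrightarrow>
     distinct [c0, c1, c2, c3, c4, c5] \<and> {c0, c1, c2, c3, c4, c5} \<subseteq> H \<and>
     (\<forall>v \<in> H. (c0 \<sim> v \<longleftrightarrow> v = c5 \<or> v = c1) \<and> (c1 \<sim> v \<longleftrightarrow> v = c0 \<or> v = c2)
       \<and> (c2 \<sim> v \<longleftrightarrow> v = c1 \<or> v = c3) \<and> (c3 \<sim> v \<longleftrightarrow> v = c2 \<or> v = c4)
       \<and> (c4 \<sim> v \<longleftrightarrow> v = c3 \<or> v = c5) \<and> (c5 \<sim> v \<longleftrightarrow> v = c4 \<or> v = c0))"

lemma (in pair_graph) hexagon_rotate:
  "hexagon H c0 c1 c2 c3 c4 c5 \<Longrightarrow> hexagon H c1 c2 c3 c4 c5 c0"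
  by (auto simp: hexagon_def)

text \<open>As degrees are at most two, \<open>other_nbr\<close> says that there are neither leaves
  nor triangles. So \<open>H\<close> induces disjoint cycles, of length at least five by
  \<open>no_4_cycle\<close>.\<close>

locale tight_leaf_cyclic = tight_leaf +
  assumes nonempty: "H \<noteq> {}"
    and other_nbr: "\<lbrakk>u \<in> H; v \<in> H; (u, v) \<in> parcs G\<rbrakk>
      \<Longrightarrow> \<exists>w \<in> H. (v, w) \<in> parcs G \<and> w \<noteq> u \<and> (u, w) \<notin> parcs G"
begin

lemma next_vertex:
  assumes "u \<in> H" "v \<in> H" "u \<sim> v"
  obtains w where "w \<in> H" "v \<sim> w" "w \<noteq> u" "w \<noteq> v" "\<not> u \<sim> w"
    "\<And>t. t \<in> H \<Longrightarrow> v \<sim> t \<longleftrightarrow> t = u \<or> t = w"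
proof -
  obtain w where w: "w \<in> H" "v \<sim> w" "w \<noteq> u" "\<not> u \<sim> w"
    using other_nbr[OF assms] by blast
  have vu: "v \<sim> u" using assms(3) by (rule adj_sym)
  show thesis
    by (rule that[of w]) (use w vu assms adj_neq[OF w(2)] D_tight_deg2(2)[OF tight, of v u w] in blast)+
qed

lemma two_nbrs:
  assumes "v \<in> H"
  obtains a b where "a \<in> H" "b \<in> H" "a \<noteq> b" "a \<noteq> v" "b \<noteq> v" "\<not> a \<sim> b"
    "\<And>t. t \<in> H \<Longrightarrow> v \<sim> t \<longleftrightarrow> t = a \<or> t = b"
proof -
  obtain a where a: "a \<in> H" "v \<sim> a" using H_nbr[OF assms] by blast
  show thesis
    using next_vertex[OF a(1) assms adj_sym[OF a(2)]] that[of a] a adj_neq[OF a(2)] by metis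
qed

lemma cut_vertex:
  assumes "\<And>u v. \<lbrakk>u \<in> K; v \<in> H; u \<sim> v\<rbrakk> \<Longrightarrow> v \<in> K" and "c \<in> H - K"
  shows "\<not> D_tight (H - K - {c})"
proof
  assume cut: "D_tight (H - K - {c})"
  have "c \<in> H" using assms(2) by blast
  then obtain a b where ab: "a \<in> H" "b \<in> H" "a \<noteq> b" "a \<noteq> c" "b \<noteq> c" "\<not> a \<sim> b"
    and c_nb: "\<And>t. t \<in> H \<Longrightarrow> c \<sim> t \<longleftrightarrow> t = a \<or> t = b"
    by (rule two_nbrs) (rule that)
  have "v \<in> H - K" if "u \<in> H - K" "v \<in> H" "u \<sim> v" for u v
    using assms(1)[of v u] that adj_sym[OF that(3)] by blast
  then show False
    using cut_cycle[of "H - K" c a b] assms(2) ab c_nb[of a] c_nb[of b] cut by blast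
qed

text \<open>
  Staller's answer \<open>c1\<close> to \<open>c0\<close> leaves a path ending in \<open>c3\<close>, which tightness forces to have two or three
  vertices: the cycle has length 6 or 7. For length 7 Dominator takes the middle of the remaining
  path, and then Staller can only use \<open>y\<close>, which cuts another cycle.
\<close>

lemma staller_extends:
  assumes c: "c0 \<in> H" "c1 \<in> H" "m \<in> H" "c1 \<noteq> m"
    and c0: "\<And>t. t \<in> H \<Longrightarrow> c0 \<sim> t \<longleftrightarrow> t = c1 \<or> t = m"
    and c2: "c2 \<in> H - {c0, c1, m}" "c1 \<sim> c2" and U: "D_tight (H - {c0, c1, m} - {c2})"
  shows "\<exists>c3 c4. hexagon H c0 c1 c2 c3 c4 m"
proof -
  let ?U = "H - {c0, c1, m} - {c2}"
  have c01: "c0 \<sim> c1" "c0 \<sim> m" "c0 \<noteq> c1" "c0 \<noteq> m" using c0 c adj_neq by blast+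
  have c1: "t \<in> H \<Longrightarrow> c1 \<sim> t \<longleftrightarrow> t = c0 \<or> t = c2" for t
    using D_tight_deg2(2)[OF tight, of c1 c0 c2] c c2 c01(1) adj_sym by blast
  obtain c3 where c3: "c3 \<in> H" "c2 \<sim> c3" "c3 \<noteq> c1" "c3 \<noteq> c2" "\<not> c1 \<sim> c3"
    and c2': "\<And>t. t \<in> H \<Longrightarrow> c2 \<sim> t \<longleftrightarrow> t = c1 \<or> t = c3"
    using next_vertex[of c1 c2] c c2 by blast
  have "c3 \<noteq> c0" using c3(2) c0[of c2] c2(1) adj_sym by blast
  moreover have "c3 \<noteq> m"
    using no_4_cycle[of c0 c1 c2 m] c c01 c2 c3 adj_sym by blast
  ultimately have c3U: "c3 \<in> ?U" using c3 by blast
  obtain c4 where c4: "c4 \<in> H" "c3 \<sim> c4" "c4 \<noteq> c2" "c4 \<noteq> c3" "\<not> c2 \<sim> c4"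
    and c3': "\<And>t. t \<in> H \<Longrightarrow> c3 \<sim> t \<longleftrightarrow> t = c2 \<or> t = c4"
    using next_vertex[of c2 c3] c2 c3 by blast
  have c4U: "c4 \<in> ?U"
    using D_tight_nbr[OF U c3U] c3' by blast
  obtain c5 where c5: "c5 \<in> H" "c4 \<sim> c5" "c5 \<noteq> c3" "c5 \<noteq> c4" "\<not> c3 \<sim> c5"
    and c4': "\<And>t. t \<in> H \<Longrightarrow> c4 \<sim> t \<longleftrightarrow> t = c3 \<or> t = c5"
    using next_vertex[of c3 c4] c3 c4 by blast
  have c5_neq: "c5 \<noteq> c0" "c5 \<noteq> c1" "c5 \<noteq> c2"
    using c0[of c4] c1[of c4] c4U c4(5) adj_sym[OF c5(2)] c4(1) by blast+
  have mc0: "m \<sim> c0" using c01(2) by (rule adj_sym)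
  show ?thesis
  proof (cases "c5 = m")
    case True
    then have "t \<in> H \<Longrightarrow> m \<sim> t \<longleftrightarrow> t = c4 \<or> t = c0" for t
      using D_tight_deg2(2)[OF tight, of m c4 c0] adj_sym[OF c5(2)] mc0 c c4U by blast
    then have "hexagon H c0 c1 c2 c3 c4 m"
      unfolding hexagon_def
      using c0 c1 c2' c3' c4' True c c01 c2 c3 c3U c4U c4 by auto
    then show ?thesis by blast
  next
    case False
    then have c5U: "c5 \<in> ?U" using c5 c5_neq by blast
    \<comment> \<open>In \<open>?U\<close> the vertex \<open>c3\<close> is a leaf at
      \<open>c4\<close>, because \<open>c2\<close> is gone; its component there ends with
      \<open>c5\<close>.\<close>
    have c5_only: "t = c4" if "t \<in> ?U" "c5 \<sim> t" for t
      using D_tight_leaf[OF U, of c3 c4 c5 t] c3U c4U c5U c3' c5 that by blast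
    obtain c6 where c6: "c6 \<in> H" "c5 \<sim> c6" "c6 \<noteq> c4" "c6 \<noteq> c5" "\<not> c4 \<sim> c6"
      and c5': "\<And>t. t \<in> H \<Longrightarrow> c5 \<sim> t \<longleftrightarrow> t = c4 \<or> t = c6"
      by (rule next_vertex[OF c4(1) c5(1,2)]) (rule that)
    have "c6 \<noteq> c0" "c6 \<noteq> c1" "c6 \<noteq> c2"
      using c0[of c5] c1[of c5] c2'[of c5] c5U c5(3) adj_sym[OF c6(2)] by blast+
    then have c6m: "c6 = m" using c5_only[of c6] c6 by blast
    then have m: "t = c5 \<or> t = c0" if "t \<in> H" "m \<sim> t" for t
      using D_tight_deg2(2)[OF tight, of m c5 c0 t] adj_sym[OF c6(2)] mc0 c(1,3) c5(1) c5_neq(1) that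
      by blast
    let ?K = "{c0, c1, c2, c3, c4, c5, m}"
    have closed: "v \<in> ?K" if "u \<in> ?K" "v \<in> H" "u \<sim> v" for u v
      using that c0[of v] c1[of v] c2'[of v] c3'[of v] c4'[of v] c5'[of v] c6m m[of v] by blast
    have "S_tight (?U - {c4, c3, c5})"
      using D_tight_deg2(1)[OF U, of c4 c3 c5] c3U c4U c5U c4'[of c3] c5(2,3) by blast
    moreover have "?U - {c4, c3, c5} = H - ?K" by blast
    ultimately have tK: "S_tight (H - ?K)" by simp
    then obtain w t where w: "w \<in> insert y ?K" "t \<in> H - ?K" "w \<sim> t" "D_tight (H - ?K - {t})"
      using S_move[OF tK] by blast
    then show ?thesis
      using cut_vertex[of ?K t] closed by blast
  qed
qed

text \<open>
  If there were another component, Dominator would play \<open>c0\<close>, opposite to the neighbor \<open>c3\<close> of \<open>y\<close>;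
  Staller's answer on the 6-cycle leaves an edge at \<open>c3\<close>, and then \<open>y\<close> is too strong a move.
\<close>

lemma hexagon_covers_aux:
  assumes hex: "hexagon H c0 c1 c2 c3 c4 c5" and "y \<sim> c3"
  shows "H = {c0, c1, c2, c3, c4, c5}"
proof (rule ccontr)
  let ?K = "{c0, c1, c2, c3, c4, c5}"
  assume "H \<noteq> ?K"
  then have "H - ?K \<noteq> {}" using hex by (auto simp: hexagon_def)
  have closed: "v \<in> ?K" if "u \<in> ?K" "v \<in> H" "u \<sim> v" for u v
    using that hex unfolding hexagon_def by blast
  obtain b where b: "b \<in> H - ?K" "y \<sim> b"
    using complement_meets[of ?K] \<open>H - ?K \<noteq> {}\<close> closed by metis
  have cH: "c0 \<in> H" "c1 \<in> H" "c2 \<in> H" "c3 \<in> H" "c4 \<in> H" "c5 \<in> H"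
    and dist: "distinct [c0, c1, c2, c3, c4, c5]"
    using hex by (auto simp: hexagon_def)
  have nb: "\<And>v. v \<in> H \<Longrightarrow> c0 \<sim> v \<longleftrightarrow> v = c5 \<or> v = c1" "\<And>v. v \<in> H \<Longrightarrow> c1 \<sim> v \<longleftrightarrow> v = c0 \<or> v = c2"
    "\<And>v. v \<in> H \<Longrightarrow> c2 \<sim> v \<longleftrightarrow> v = c1 \<or> v = c3" "\<And>v. v \<in> H \<Longrightarrow> c4 \<sim> v \<longleftrightarrow> v = c3 \<or> v = c5"
    "\<And>v. v \<in> H \<Longrightarrow> c5 \<sim> v \<longleftrightarrow> v = c4 \<or> v = c0"
    using hex unfolding hexagon_def by blast+
  have "S_tight (H - {c0, c1, c5})"
    using D_tight_deg2(1)[OF tight, of c0 c1 c5] nb(1) cH dist by auto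
  then obtain w t where w: "w \<in> insert y {c0, c1, c5}" "t \<in> H - {c0, c1, c5}" "w \<sim> t"
    "\<forall>u \<in> H - {c0, c1, c5}. w \<sim> u \<longrightarrow> u = t" "D_tight (H - {c0, c1, c5} - {t})"
    using S_move[of "H - {c0, c1, c5}"] cH by blast
  have c3: "c3 \<in> H - {c0, c1, c5}" using cH dist by auto
  have "w \<noteq> y"
    using w(4) assms(2) b c3 by blast
  then have "t = c2 \<or> t = c4"
    using w(1-3) nb(1)[of t] nb(2)[of t] nb(5)[of t] by blast
  then obtain e where e: "{t, e} = {c2, c4}" "e \<noteq> t" using dist by auto
  let ?U = "H - {c0, c1, c5} - {t}"
  have "e \<in> ?U" using e cH dist by auto
  have e_only: "u = c3" if "u \<in> ?U" "e \<sim> u" for u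
    using that e nb(3)[of u] nb(4)[of u] by (auto simp: doubleton_eq_iff)
  have "c3 \<in> ?U" "b \<in> ?U" "e \<noteq> c3" "b \<noteq> c3" "b \<noteq> e"
    using e b cH dist by (auto simp: doubleton_eq_iff)
  then have sub: "{c3, e, b} \<subseteq> ?U" and card: "card {c3, e, b} = 3"
    using \<open>e \<in> ?U\<close> by auto
  have lost: "\<forall>v \<in> {c3, e, b}. y \<sim> v \<or> (\<forall>u \<in> ?U. v \<sim> u \<longrightarrow> y \<sim> u)"
    using assms(2) b(2) e_only by blast
  have diff: "?U - {c3, e, b} = H - ?K - {b}"
    using e by blast
  have tb: "S_tight (H - ?K - {b})"
    using y_move(2)[OF w(5) sub lost card] diff by simp
  then obtain w' t' where w': "w' \<in> insert y (H - (H - ?K - {b}))" "t' \<in> H - ?K - {b}" "w' \<sim> t'"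
    "\<forall>u \<in> H - ?K - {b}. w' \<sim> u \<longrightarrow> u = t'"
    using S_move[OF tb] by blast
  \<comment> \<open>\<open>y\<close> has no neighbors left, so Staller would have to answer with
    \<open>b\<close>; but both neighbors of \<open>b\<close> on its cycle are still
    unresolved.\<close>
  have "w' \<noteq> y"
    using y_move(3)[OF w(5) sub lost card, of t'] w'(2,3) diff by blast
  moreover have "w' \<notin> ?K"
    using closed[of w' t'] w'(2,3) by blast
  ultimately have "w' = b" using w'(1) by blast
  obtain a a' where a: "a \<in> H" "a' \<in> H" "a \<noteq> a'" "a \<noteq> b" "a' \<noteq> b" "b \<sim> a" "b \<sim> a'"
    using two_nbrs[of b] b(1) by (metis DiffD1)
  then have "a \<notin> ?K" "a' \<notin> ?K"
    using closed[of a b] closed[of a' b] b(1) adj_sym by blast+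
  then show False using w'(4) a \<open>w' = b\<close> by blast
qed

text \<open>\<open>y\<close> has a neighbor on the hexagon, and a rotation moves it to the position
  of \<open>c3\<close> in \<open>hexagon_covers_aux\<close>.\<close>

lemma hexagon_covers:
  assumes hex: "hexagon H c0 c1 c2 c3 c4 c5"
  shows "H = {c0, c1, c2, c3, c4, c5}"
proof -
  have closed: "v \<in> {c0, c1, c2, c3, c4, c5}" if "u \<in> {c0, c1, c2, c3, c4, c5}" "v \<in> H" "u \<sim> v" for u v
    using that hex unfolding hexagon_def by blast
  have "\<exists>c \<in> {c0, c1, c2, c3, c4, c5}. y \<sim> c"
    by (rule closed_meets) (use hex closed in \<open>auto simp: hexagon_def\<close>)
  moreover note r1 = hexagon_rotate[OF hex]
  moreover note r2 = hexagon_rotate[OF r1]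
  moreover note r3 = hexagon_rotate[OF r2]
  moreover note r4 = hexagon_rotate[OF r3]
  moreover note r5 = hexagon_rotate[OF r4]
  ultimately show ?thesis
    using hexagon_covers_aux[OF hex] hexagon_covers_aux[OF r1] hexagon_covers_aux[OF r2]
      hexagon_covers_aux[OF r3] hexagon_covers_aux[OF r4] hexagon_covers_aux[OF r5]
    by (elim bexE insertE emptyE) (simp_all add: insert_commute)
qed

text \<open>Without a hexagon, \<open>staller_extends\<close> leaves \<open>y\<close> as Staller's
  only answer to any \<open>z\<close>, so \<open>y\<close> has exactly one neighbor in
  \<open>H\<close> outside the closed neighborhood of \<open>z\<close>. It follows that
  \<open>y\<close> has just two neighbors \<open>b1\<close>, \<open>b2\<close> in \<open>H\<close>,
  whose closed neighborhoods partition \<open>H\<close>; these six vertices form a hexagon after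
  all.\<close>

lemma ex_hexagon: "\<exists>c0 c1 c2 c3 c4 c5. hexagon H c0 c1 c2 c3 c4 c5"
proof (rule ccontr)
  assume no_hex: "\<not> ?thesis"
  have unique: "\<exists>t \<in> H. t \<noteq> z \<and> \<not> z \<sim> t \<and> y \<sim> t
      \<and> (\<forall>u \<in> H. u \<noteq> z \<and> \<not> z \<sim> u \<and> y \<sim> u \<longrightarrow> u = t)" if z: "z \<in> H" for z
  proof -
    obtain a b where ab: "a \<in> H" "b \<in> H" "a \<noteq> b" "a \<noteq> z" "b \<noteq> z" "\<not> a \<sim> b"
      and z_nb: "\<And>t. t \<in> H \<Longrightarrow> z \<sim> t \<longleftrightarrow> t = a \<or> t = b"
      using two_nbrs[OF z] by blast
    have "S_tight (H - {z, a, b})"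
      using D_tight_deg2(1)[OF tight, of z a b] z ab z_nb by blast
    then obtain w t where w: "w \<in> insert y {z, a, b}" "t \<in> H - {z, a, b}" "w \<sim> t"
      "\<forall>u \<in> H - {z, a, b}. w \<sim> u \<longrightarrow> u = t" "D_tight (H - {z, a, b} - {t})"
      using S_move[of "H - {z, a, b}"] z ab by blast
    have "w \<noteq> a"
      using staller_extends[of z a b t] z ab z_nb w no_hex by blast
    moreover have "w \<noteq> b"
      using staller_extends[of z b a t, unfolded insert_commute[of b a]] z ab z_nb w no_hex by blast
    ultimately have "w = y" using w(1-3) z_nb[of t] by blast
    then show ?thesis using w(2-4) z_nb by blast
  qed
  obtain b1 where b1: "b1 \<in> H" "y \<sim> b1"
    using closed_meets[of H] nonempty by blast
  obtain b2 where b2: "b2 \<in> H" "b2 \<noteq> b1" "\<not> b1 \<sim> b2" "y \<sim> b2"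
    and b1_u: "\<And>u. \<lbrakk>u \<in> H; u \<noteq> b1; \<not> b1 \<sim> u; y \<sim> u\<rbrakk> \<Longrightarrow> u = b2"
    using unique[OF b1(1)] by blast
  have b2_u: "u = b1" if "u \<in> H" "u \<noteq> b2" "\<not> b2 \<sim> u" "y \<sim> u" for u
    using unique[OF b2(1)] b1 b2 that adj_sym by metis
  \<comment> \<open>Otherwise both \<open>p\<close> and the vertex \<open>t\<close> given by
    \<open>unique\<close> for \<open>p\<close> are adjacent to \<open>b1\<close> and
    \<open>b2\<close>, which closes a 4-cycle.\<close>
  have no_b: "\<not> y \<sim> p" if p: "p \<in> H" "b1 \<sim> p" for p
  proof
    assume "y \<sim> p"
    have pb: "p \<noteq> b1" "p \<noteq> b2" "b2 \<sim> p"
      using p b2 b2_u[of p] \<open>y \<sim> p\<close> adj_neq by blast+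
    obtain t where t: "t \<in> H" "t \<noteq> p" "\<not> p \<sim> t" "y \<sim> t"
      using unique[OF p(1)] by blast
    then have "t \<noteq> b1" "t \<noteq> b2" using p pb adj_sym by blast+
    then have "b1 \<sim> t" "b2 \<sim> t" using b1_u[of t] b2_u[of t] t by blast+
    then show False
      using no_4_cycle[of b1 p b2 t] b1 b2 p pb t adj_sym by blast
  qed
  have B: "v = b1 \<or> v = b2" if "v \<in> H" "y \<sim> v" for v
    using b1_u[of v] no_b[of v] that by blast
  \<comment> \<open>Uniqueness keeps \<open>z\<close> from missing both \<open>b1\<close> and
    \<open>b2\<close>; existence, in \<open>disj\<close>, keeps it from being adjacent to
    both.\<close>
  have cover: "z = b1 \<or> z = b2 \<or> b1 \<sim> z \<or> b2 \<sim> z" if "z \<in> H" for z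
    using unique[OF that] b1 b2 adj_sym by metis
  have disj: "\<not> (b1 \<sim> z \<and> b2 \<sim> z)" if "z \<in> H" for z
    using unique[OF that] B adj_sym by metis
  obtain p q where pq: "p \<in> H" "q \<in> H" "p \<noteq> q" "p \<noteq> b1" "q \<noteq> b1" "\<not> p \<sim> q"
    and b1_nb: "\<And>t. t \<in> H \<Longrightarrow> b1 \<sim> t \<longleftrightarrow> t = p \<or> t = q"
    using two_nbrs[OF b1(1)] by blast
  \<comment> \<open>The second neighbor \<open>r\<close> of \<open>v\<close> is not adjacent to
    \<open>b1\<close>, as there are no triangles, so by \<open>cover\<close> it is adjacent to
    \<open>b2\<close>.\<close>
  have other: "\<exists>r \<in> H. b2 \<sim> r \<and> r \<noteq> b1 \<and> r \<noteq> b2 \<and> r \<noteq> p \<and> r \<noteq> q \<and> (\<forall>t \<in> H. v \<sim> t \<longleftrightarrow> t = b1 \<or> t = r)"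
    if v: "v = p \<or> v = q" for v
  proof -
    have vH: "v \<in> H" "b1 \<sim> v" using v pq b1_nb by blast+
    obtain r where r: "r \<in> H" "v \<sim> r" "r \<noteq> b1" "r \<noteq> v" "\<not> b1 \<sim> r"
      "\<And>t. t \<in> H \<Longrightarrow> v \<sim> t \<longleftrightarrow> t = b1 \<or> t = r"
      using next_vertex[OF b1(1) vH] by blast
    have "r \<noteq> b2" using disj[OF vH(1)] vH(2) r(2) adj_sym by blast
    then show ?thesis using cover[OF r(1)] r b1_nb by blast
  qed
  obtain r where r: "r \<in> H" "b2 \<sim> r" "r \<noteq> b1" "r \<noteq> b2" "r \<noteq> p" "r \<noteq> q"
    and p_nb: "\<And>t. t \<in> H \<Longrightarrow> p \<sim> t \<longleftrightarrow> t = b1 \<or> t = r"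
    using other[of p] by blast
  obtain s where s: "s \<in> H" "b2 \<sim> s" "s \<noteq> b1" "s \<noteq> b2" "s \<noteq> p" "s \<noteq> q"
    and q_nb: "\<And>t. t \<in> H \<Longrightarrow> q \<sim> t \<longleftrightarrow> t = b1 \<or> t = s"
    using other[of q] by blast
  have adj: "b1 \<sim> p" "p \<sim> r" "r \<sim> p" "q \<sim> b1" "q \<sim> s" "s \<sim> q" "r \<sim> b2" "s \<sim> b2"
    using b1_nb p_nb q_nb pq b1(1) r s adj_sym by blast+
  have "r \<noteq> s"
    using no_4_cycle[of b1 p r q] b1(1) pq r adj adj_sym[OF adj(5)] by blast
  have bpq: "b2 \<noteq> p" "b2 \<noteq> q" using b2 b1_nb by blast+
  have r_nb: "t \<in> H \<Longrightarrow> r \<sim> t \<longleftrightarrow> t = p \<or> t = b2" for t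
    using D_tight_deg2(2)[OF tight, of r p b2 t] r pq b2 adj bpq by blast
  have s_nb: "t \<in> H \<Longrightarrow> s \<sim> t \<longleftrightarrow> t = b2 \<or> t = q" for t
    using D_tight_deg2(2)[OF tight, of s q b2 t] s pq b2 adj bpq by blast
  have b2_nb: "t \<in> H \<Longrightarrow> b2 \<sim> t \<longleftrightarrow> t = r \<or> t = s" for t
    using D_tight_deg2(2)[OF tight, of b2 r s t] r s b2 \<open>r \<noteq> s\<close> by blast
  have "hexagon H b1 p r b2 s q"
    unfolding hexagon_def
    using b1(1) b2(1,2) pq r s \<open>r \<noteq> s\<close> bpq b1_nb p_nb r_nb b2_nb s_nb q_nb by auto
  then show False using no_hex by blast
qed

end

section \<open>Identification of the extremal graphs\<close>

text \<open>The vertex \<open>vs ! i\<close> gets the label \<open>Suc i\<close>. Only pairs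
  \<open>i < j\<close> are compared, so for a concrete list \<open>adj\<close> is settled by
  simplification.\<close>

lemma (in pair_graph) digraph_iso_graph_onI:
  assumes vs: "distinct vs" "set vs = pverts G" "length vs = n"
    and E: "E \<subseteq> {1..n} \<times> {1..n}" "\<And>i. (i, i) \<notin> E"
    and adj: "\<forall>j<n. \<forall>i<j. vs ! i \<sim> vs ! j \<longleftrightarrow> (Suc i, Suc j) \<in> E \<or> (Suc j, Suc i) \<in> E"
  shows "digraph_iso (with_proj G) (with_proj (graph_on n E))"
proof -
  let ?F = "graph_on n E"
  define g where "g i = vs ! (i - 1)" for i
  interpret F: pair_wf_digraph ?F
    using E(1) by unfold_locales (auto simp: graph_on_def)
  have inj: "inj_on g {1..n}"
    using vs by (auto simp: g_def inj_on_def nth_eq_iff_index_eq)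
  have g_verts: "g ` {1..n} = pverts G"
  proof -
    have "g ` {1..n} = (!) vs ` {..<n}"
      by (force simp: g_def image_iff intro: bexI[of _ "Suc _"])
    then show ?thesis using vs by (auto simp: set_conv_nth)
  qed
  have adj': "g i \<sim> g j \<longleftrightarrow> (i, j) \<in> E \<union> E\<inverse>" if "i \<in> {1..n}" "j \<in> {1..n}" for i j
  proof (cases i j rule: linorder_cases)
    case less
    then show ?thesis using that adj[rule_format, of "j - 1" "i - 1"] by (auto simp: g_def)
  next
    case equal
    then show ?thesis using E(2) adj_neq by auto
  next
    case greater
    have "g i \<sim> g j \<longleftrightarrow> g j \<sim> g i" using adj_sym by blast
    then show ?thesis using greater that adj[rule_format, of "i - 1" "j - 1"] by (auto simp: g_def)
  qed
  define hom where "hom = \<lparr>iso_verts = g, iso_arcs = map_prod g g, iso_head = snd, iso_tail = fst\<rparr>"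
  have arcs_sub: "parcs ?F \<subseteq> {1..n} \<times> {1..n}"
    using E(1) by (auto simp: graph_on_def)
  have "inj_on (map_prod g g) (parcs ?F)"
    using map_prod_inj_on[OF inj inj] arcs_sub inj_on_subset by blast
  then have "pre_digraph.digraph_isomorphism (with_proj ?F) hom"
    using inj F.wf_digraph_axioms
    by (auto simp: pre_digraph.digraph_isomorphism_def hom_def graph_on_def)
  moreover have "with_proj G = app_iso hom (with_proj ?F)"
  proof -
    have "map_prod g g ` parcs ?F = parcs G"
    proof (intro equalityI subsetI)
      fix a assume "a \<in> map_prod g g ` parcs ?F"
      then show "a \<in> parcs G"
        using adj' arcs_sub by (auto simp: graph_on_def)
    next
      fix a assume a: "a \<in> parcs G"
      obtain u v where uv: "a = (u, v)" by fastforce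
      then have "u \<in> g ` {1..n}" "v \<in> g ` {1..n}" using a adj_verts g_verts by auto
      then obtain i j where "i \<in> {1..n}" "j \<in> {1..n}" "u = g i" "v = g j" by blast
      then show "a \<in> map_prod g g ` parcs ?F"
        using a uv adj'[of i j] by (auto simp: graph_on_def)
    qed
    then show ?thesis
      using g_verts by (simp add: app_iso_def hom_def with_proj_def graph_on_def)
  qed
  ultimately have "digraph_iso (with_proj ?F) (with_proj G)"
    unfolding digraph_iso_def by blast
  then show ?thesis
    using digraph_iso_swap F.wf_digraph_axioms by blast
qed

section \<open>Matching the possible positions with the listed graphs\<close>

context tight_leaf
begin

lemma adj_x: "v \<sim> x \<longleftrightarrow> v = y"
  using x_adj adj_sym by blast

lemma x_neq_y: "x \<noteq> y"
  using x_adj adj_neq by blast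

lemma y_nbr_sym: "v \<sim> y \<longleftrightarrow> y \<sim> v"
  using adj_sym by blast

lemma iso_empty: "H = {} \<Longrightarrow> digraph_iso (with_proj G) (with_proj F1)"
  unfolding F1_def
  by (rule digraph_iso_graph_onI[of "[x, y]"])
    (use verts x_neq_y x_adj in \<open>auto simp: numeral_eq_Suc All_less_Suc\<close>)

lemma iso_edge:
  assumes "H = {p, q}"
  shows "\<exists>F \<in> {F2, F3}. digraph_iso (with_proj G) (with_proj F)"
proof -
  have "p \<sim> q" using H_nbr[of p] assms adj_neq by blast
  then have pq: "p \<sim> q" "q \<sim> p" "p \<noteq> q" using adj_sym adj_neq by blast+
  have neq: "x \<noteq> p" "x \<noteq> q" "y \<noteq> p" "y \<noteq> q" "x \<noteq> y" using not_in_H assms x_neq_y by auto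
  have "y \<sim> p \<or> y \<sim> q"
    using closed_meets[of H] assms by blast
  then consider "y \<sim> p" "y \<sim> q" | "y \<sim> p" "\<not> y \<sim> q" | "\<not> y \<sim> p" "y \<sim> q" by blast
  then show ?thesis
  proof cases
    case 1
    then have "digraph_iso (with_proj G) (with_proj F3)"
      unfolding F3_def
      by (intro digraph_iso_graph_onI[of "[y, p, q, x]"])
        (use verts assms pq neq neq[symmetric] in \<open>auto simp: numeral_eq_Suc All_less_Suc adj_x\<close>)
    then show ?thesis by blast
  next
    case 2
    then have "digraph_iso (with_proj G) (with_proj F2)"
      unfolding F2_def
      by (intro digraph_iso_graph_onI[of "[x, y, p, q]"])
        (use verts assms pq neq neq[symmetric] in \<open>auto simp: numeral_eq_Suc All_less_Suc x_adj\<close>)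
    then show ?thesis by blast
  next
    case 3
    then have "digraph_iso (with_proj G) (with_proj F2)"
      unfolding F2_def
      by (intro digraph_iso_graph_onI[of "[x, y, q, p]"])
        (use verts assms pq neq neq[symmetric] in \<open>auto simp: numeral_eq_Suc All_less_Suc x_adj\<close>)
    then show ?thesis by blast
  qed
qed

text \<open>Only the pairs \<open>e\<close>, \<open>g\<close> and \<open>c\<close>, \<open>s\<close>
  are undetermined: no edge gives \<open>F4\<close>, one gives \<open>F5\<close>, both give
  \<open>F6\<close>.\<close>

lemma iso_two_arms:
  assumes dist: "distinct [e, f, g, c, t, s]" and H: "H = {e, f, g, c, t, s}"
    and efg: "e \<sim> f" "f \<sim> g" "y \<sim> e" "\<not> y \<sim> f" "\<not> y \<sim> g"
    and cts: "c \<sim> t" "t \<sim> s" "y \<sim> c" "\<not> y \<sim> t" "\<not> y \<sim> s"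
    and sep: "\<forall>u \<in> {e, f, g}. \<forall>v \<in> {c, t, s}. \<not> u \<sim> v"
  shows "\<exists>F \<in> {F4, F5, F6}. digraph_iso (with_proj G) (with_proj F)"
proof -
  have sym: "f \<sim> e" "g \<sim> f" "t \<sim> c" "s \<sim> t" using efg cts adj_sym by blast+
  have sep': "\<forall>u \<in> {e, f, g}. \<forall>v \<in> {c, t, s}. \<not> v \<sim> u" using sep adj_sym by blast
  have neq: "x \<noteq> y" "x \<notin> H" "y \<notin> H" using not_in_H x_neq_y by auto
  \<comment> \<open>Two labellings are used because \<open>F5\<close> has its triangle on 1, 2, 3:
    the component of \<open>c\<close> comes first if it alone is a triangle.\<close>
  have dist1: "distinct [g, f, e, y, c, t, s, x]" and set1: "set [g, f, e, y, c, t, s, x] = pverts G"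
    and dist2: "distinct [s, t, c, y, e, f, g, x]" and set2: "set [s, t, c, y, e, f, g, x] = pverts G"
    using dist H neq verts by auto
  note facts = efg cts sym sep[simplified] sep'[simplified]
  show ?thesis
  proof (cases "e \<sim> g")
    case eg: True
    then have ge: "g \<sim> e" by (rule adj_sym)
    show ?thesis
    proof (cases "c \<sim> s")
      case True
      then have "digraph_iso (with_proj G) (with_proj F6)"
        unfolding F6_def
        by (intro digraph_iso_graph_onI[OF dist1 set1])
          (use facts eg ge in \<open>auto simp: numeral_eq_Suc All_less_Suc adj_x y_nbr_sym\<close>)
      then show ?thesis by blast
    next
      case False
      then have "digraph_iso (with_proj G) (with_proj F5)"
        unfolding F5_def
        by (intro digraph_iso_graph_onI[OF dist1 set1])
          (use facts eg ge in \<open>auto simp: numeral_eq_Suc All_less_Suc adj_x y_nbr_sym\<close>)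
      then show ?thesis by blast
    qed
  next
    case eg: False
    then have ge: "\<not> g \<sim> e" using adj_sym by blast
    show ?thesis
    proof (cases "c \<sim> s")
      case True
      then have "s \<sim> c" by (rule adj_sym)
      with True have "digraph_iso (with_proj G) (with_proj F5)"
        unfolding F5_def
        by (intro digraph_iso_graph_onI[OF dist2 set2])
          (use facts eg ge in \<open>auto simp: numeral_eq_Suc All_less_Suc adj_x y_nbr_sym\<close>)
      then show ?thesis by blast
    next
      case False
      then have "digraph_iso (with_proj G) (with_proj F4)"
        unfolding F4_def
        by (intro digraph_iso_graph_onI[OF dist1 set1])
          (use facts eg ge in \<open>auto simp: numeral_eq_Suc All_less_Suc adj_x y_nbr_sym\<close>)
      then show ?thesis by blast
    qed
  qed
qed

lemma iso_hexagon_graph: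
  assumes hex: "hexagon H c0 c1 c2 c3 c4 c5" and H: "H = {c0, c1, c2, c3, c4, c5}"
    and J: "J \<subseteq> {1..6}" and y: "y \<sim> c0 \<longleftrightarrow> 1 \<in> J" "y \<sim> c1 \<longleftrightarrow> 2 \<in> J" "y \<sim> c2 \<longleftrightarrow> 3 \<in> J"
      "y \<sim> c3 \<longleftrightarrow> 4 \<in> J" "y \<sim> c4 \<longleftrightarrow> 5 \<in> J" "y \<sim> c5 \<longleftrightarrow> 6 \<in> J"
  shows "digraph_iso (with_proj G) (with_proj (hexagon_graph J))"
proof -
  let ?vs = "[c0, c1, c2, c3, c4, c5, x, y]"
  have neq: "x \<noteq> y" "x \<notin> H" "y \<notin> H" using not_in_H x_neq_y by auto
  have dist: "distinct [c0, c1, c2, c3, c4, c5]"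
    using hex by (auto simp: hexagon_def)
  have nb: "c0 \<sim> c1" "\<not> c0 \<sim> c2" "\<not> c0 \<sim> c3" "\<not> c0 \<sim> c4" "c0 \<sim> c5"
    "c1 \<sim> c2" "\<not> c1 \<sim> c3" "\<not> c1 \<sim> c4" "\<not> c1 \<sim> c5" "c2 \<sim> c3" "\<not> c2 \<sim> c4" "\<not> c2 \<sim> c5"
    "c3 \<sim> c4" "\<not> c3 \<sim> c5" "c4 \<sim> c5"
    using hex dist unfolding hexagon_def by auto
  have dist': "distinct ?vs" and set': "set ?vs = pverts G"
    using dist neq H verts by auto
  have J7: "7 \<notin> J" "8 \<notin> J" using J by auto
  have cy: "c0 \<noteq> y" "c1 \<noteq> y" "c2 \<noteq> y" "c3 \<noteq> y" "c4 \<noteq> y" "c5 \<noteq> y"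
    using neq H by auto
  show ?thesis
    unfolding hexagon_graph_def
  proof (rule digraph_iso_graph_onI[OF dist' set'])
    let ?E = "{(1, 2), (2, 3), (3, 4), (4, 5), (5, 6), (6, 1), (7, 8)} \<union> {8 :: nat} \<times> J"
    show "?E \<subseteq> {1..8} \<times> {1..8}" using J by auto
    show "(i, i) \<notin> ?E" for i using J7 by auto
    show "\<forall>j<8. \<forall>i<j. ?vs ! i \<sim> ?vs ! j \<longleftrightarrow> (Suc i, Suc j) \<in> ?E \<or> (Suc j, Suc i) \<in> ?E"
      using nb y J7 cy by (simp add: numeral_eq_Suc All_less_Suc adj_x x_adj y_nbr_sym)
  qed simp
qed

text \<open>The move \<open>y\<close> also resolves \<open>c1\<close>, both of whose neighbors it
  dominates; one more neighbor would be a fourth resolved vertex.\<close>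

lemma hexagon_distance_2:
  assumes hex: "hexagon H c0 c1 c2 c3 c4 c5" and "y \<sim> c0" "y \<sim> c2"
  shows "\<not> y \<sim> c3 \<and> \<not> y \<sim> c4 \<and> \<not> y \<sim> c5"
proof -
  have "\<not> y \<sim> v" if v: "v \<in> {c3, c4, c5}" for v
  proof
    assume "y \<sim> v"
    then have "\<forall>u \<in> {c0, c1, c2, v}. y \<sim> u \<or> (\<forall>w \<in> H. u \<sim> w \<longrightarrow> y \<sim> w)"
      using assms unfolding hexagon_def by auto
    then have "card {c0, c1, c2, v} \<le> 3"
      using hex v by (intro y_move(1)[OF tight]) (auto simp: hexagon_def)
    moreover have "distinct [c0, c1, c2, c3, c4, c5]"
      using hex by (simp add: hexagon_def)
    then have "card {c0, c1, c2, v} = 4"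
      using v by auto
    ultimately show False by simp
  qed
  then show ?thesis by blast
qed

lemma iso_hexagon_aux:
  assumes hex: "hexagon H c0 c1 c2 c3 c4 c5" and H: "H = {c0, c1, c2, c3, c4, c5}" and "y \<sim> c0"
  shows "\<exists>F \<in> {F7, F8, F9, F10, F11}. digraph_iso (with_proj G) (with_proj F)"
proof -
  note r1 = hexagon_rotate[OF hex]
  note r2 = hexagon_rotate[OF r1]
  note r3 = hexagon_rotate[OF r2]
  note r4 = hexagon_rotate[OF r3]
  note r5 = hexagon_rotate[OF r4]
  note excl = hexagon_distance_2[OF hex] hexagon_distance_2[OF r1] hexagon_distance_2[OF r2]
    hexagon_distance_2[OF r3] hexagon_distance_2[OF r4] hexagon_distance_2[OF r5]
  have H1: "H = {c1, c2, c3, c4, c5, c0}" and H4: "H = {c4, c5, c0, c1, c2, c3}"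
    and H5: "H = {c5, c0, c1, c2, c3, c4}"
    using H by blast+
  \<comment> \<open>These are the neighbor sets containing \<open>c0\<close> that survive
    \<open>hexagon_distance_2\<close> in all six rotations. In each case a rotation matches the
    labels of the graph in the list.\<close>
  consider "\<not> y \<sim> c1" "\<not> y \<sim> c2" "\<not> y \<sim> c3" "\<not> y \<sim> c4" "\<not> y \<sim> c5"
    | "y \<sim> c1" "\<not> y \<sim> c2" "\<not> y \<sim> c3" "\<not> y \<sim> c4" "\<not> y \<sim> c5"
    | "\<not> y \<sim> c1" "\<not> y \<sim> c2" "\<not> y \<sim> c3" "\<not> y \<sim> c4" "y \<sim> c5"
    | "\<not> y \<sim> c1" "y \<sim> c2" "\<not> y \<sim> c3" "\<not> y \<sim> c4" "\<not> y \<sim> c5"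
    | "\<not> y \<sim> c1" "\<not> y \<sim> c2" "\<not> y \<sim> c3" "y \<sim> c4" "\<not> y \<sim> c5"
    | "\<not> y \<sim> c1" "\<not> y \<sim> c2" "y \<sim> c3" "\<not> y \<sim> c4" "\<not> y \<sim> c5"
    | "y \<sim> c1" "\<not> y \<sim> c2" "\<not> y \<sim> c3" "\<not> y \<sim> c4" "y \<sim> c5"
    | "y \<sim> c1" "y \<sim> c2" "\<not> y \<sim> c3" "\<not> y \<sim> c4" "\<not> y \<sim> c5"
    | "\<not> y \<sim> c1" "\<not> y \<sim> c2" "\<not> y \<sim> c3" "y \<sim> c4" "y \<sim> c5"
    using excl assms(3) by argo
  then show ?thesis
  proof cases
    case 1
    then have "digraph_iso (with_proj G) (with_proj F7)"
      unfolding F7_def using assms(3) by (intro iso_hexagon_graph[OF hex H]) auto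
    then show ?thesis by blast
  next
    case 2
    then have "digraph_iso (with_proj G) (with_proj F8)"
      unfolding F8_def using assms(3) by (intro iso_hexagon_graph[OF hex H]) auto
    then show ?thesis by blast
  next
    case 3
    then have "digraph_iso (with_proj G) (with_proj F8)"
      unfolding F8_def using assms(3) by (intro iso_hexagon_graph[OF r5 H5]) auto
    then show ?thesis by blast
  next
    case 4
    then have "digraph_iso (with_proj G) (with_proj F9)"
      unfolding F9_def using assms(3) by (intro iso_hexagon_graph[OF hex H]) auto
    then show ?thesis by blast
  next
    case 5
    then have "digraph_iso (with_proj G) (with_proj F9)"
      unfolding F9_def using assms(3) by (intro iso_hexagon_graph[OF r4 H4]) auto
    then show ?thesis by blast
  next
    case 6
    then have "digraph_iso (with_proj G) (with_proj F10)"
      unfolding F10_def using assms(3) by (intro iso_hexagon_graph[OF hex H]) auto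
    then show ?thesis by blast
  next
    case 7
    then have "digraph_iso (with_proj G) (with_proj F11)"
      unfolding F11_def using assms(3) by (intro iso_hexagon_graph[OF hex H]) auto
    then show ?thesis by blast
  next
    case 8
    then have "digraph_iso (with_proj G) (with_proj F11)"
      unfolding F11_def using assms(3) by (intro iso_hexagon_graph[OF r1 H1]) auto
    then show ?thesis by blast
  next
    case 9
    then have "digraph_iso (with_proj G) (with_proj F11)"
      unfolding F11_def using assms(3) by (intro iso_hexagon_graph[OF r5 H5]) auto
    then show ?thesis by blast
  qed
qed

end

lemma (in tight_leaf_cyclic) iso_hexagon:
  "\<exists>F \<in> {F7, F8, F9, F10, F11}. digraph_iso (with_proj G) (with_proj F)"
proof -
  obtain c0 c1 c2 c3 c4 c5 where hex: "hexagon H c0 c1 c2 c3 c4 c5"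
    using ex_hexagon by blast
  have H: "H = {c0, c1, c2, c3, c4, c5}" using hexagon_covers[OF hex] .
  have "\<exists>c \<in> {c0, c1, c2, c3, c4, c5}. y \<sim> c"
    using closed_meets[of H] nonempty H by blast
  moreover note r1 = hexagon_rotate[OF hex]
  moreover note r2 = hexagon_rotate[OF r1]
  moreover note r3 = hexagon_rotate[OF r2]
  moreover note r4 = hexagon_rotate[OF r3]
  moreover note r5 = hexagon_rotate[OF r4]
  ultimately show ?thesis
    using iso_hexagon_aux[OF hex hexagon_covers[OF hex]] iso_hexagon_aux[OF r1 hexagon_covers[OF r1]]
      iso_hexagon_aux[OF r2 hexagon_covers[OF r2]] iso_hexagon_aux[OF r3 hexagon_covers[OF r3]]
      iso_hexagon_aux[OF r4 hexagon_covers[OF r4]] iso_hexagon_aux[OF r5 hexagon_covers[OF r5]]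
    by blast
qed

text \<open>If \<open>H\<close> is neither empty nor an edge and has no component of order three, it
  has no leaf, since a leaf lies in a component of order at most three, and no triangle, which by
  maximum degree two would be a component. So the cyclic case applies.\<close>

theorem (in tight_leaf) classification:
  "\<exists>F \<in> {F1, F2, F3, F4, F5, F6, F7, F8, F9, F10, F11}. digraph_iso (with_proj G) (with_proj F)"
proof -
  let ?triple = "\<exists>z a b. z \<in> H \<and> a \<in> H \<and> b \<in> H \<and> a \<noteq> b \<and> z \<sim> a \<and> z \<sim> b \<and>
    (\<forall>u \<in> {z, a, b}. \<forall>v \<in> H. u \<sim> v \<longrightarrow> v \<in> {z, a, b})"
  have "tight_leaf_cyclic G x y H"
    if ne: "H \<noteq> {}" and no_edge: "\<not> (\<exists>p q. H = {p, q})" and no_triple: "\<not> ?triple"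
  proof (unfold_locales, rule ne)
    fix u v assume uv: "u \<in> H" "v \<in> H" "u \<sim> v"
    then have vu: "v \<sim> u" using adj_sym by blast
    have "\<exists>w \<in> H. v \<sim> w \<and> w \<noteq> u"
    proof (rule ccontr)
      assume "\<not> ?thesis"
      then have v_only: "w = u" if "w \<in> H" "v \<sim> w" for w using that by blast
      obtain r where r: "r \<in> H" "u \<sim> r" "r \<noteq> v"
        using isolated_edge[of v u] no_edge uv vu v_only by blast
      have "w = u" if "w \<in> H" "r \<sim> w" for w
        using D_tight_leaf[OF tight, of v u r w] uv r v_only that by blast
      moreover have "w = v \<or> w = r" if "w \<in> H" "u \<sim> w" for w
        using D_tight_deg2(2)[OF tight, of u v r w] uv r that by blast
      ultimately have "\<forall>w \<in> {u, v, r}. \<forall>t \<in> H. w \<sim> t \<longrightarrow> t \<in> {u, v, r}"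
        using v_only by blast
      then show False
        using no_triple uv r by blast
    qed
    then obtain w where w: "w \<in> H" "v \<sim> w" "w \<noteq> u" by blast
    have "\<not> u \<sim> w"
    proof
      assume "u \<sim> w"
      have wadj: "w \<sim> v" "w \<sim> u" using w(2) \<open>u \<sim> w\<close> adj_sym by blast+
      have neq: "v \<noteq> w" "u \<noteq> v" using adj_neq w(2) uv(3) by blast+
      have "\<forall>z \<in> {u, v, w}. \<forall>t \<in> H. z \<sim> t \<longrightarrow> t \<in> {u, v, w}"
        using D_tight_deg2(2)[OF tight uv(1) uv(2) w(1) neq(1) uv(3) \<open>u \<sim> w\<close>]
          D_tight_deg2(2)[OF tight uv(2) uv(1) w(1) w(3)[symmetric] vu w(2)]
          D_tight_deg2(2)[OF tight w(1) uv(1) uv(2) neq(2) wadj(2) wadj(1)] by blast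
      then show False
        using no_triple uv(1,2) w(1) neq(1) uv(3) \<open>u \<sim> w\<close> by blast
    qed
    then show "\<exists>w \<in> H. v \<sim> w \<and> w \<noteq> u \<and> \<not> u \<sim> w" using w by blast
  qed
  then consider "H = {}" | "\<exists>p q. H = {p, q}" | ?triple | "tight_leaf_cyclic G x y H"
    by argo
  then show ?thesis
  proof cases
    case 1
    then show ?thesis using iso_empty by blast
  next
    case 2
    then show ?thesis using iso_edge by blast
  next
    case 3
    then obtain z a b where z: "z \<in> H" "a \<in> H" "b \<in> H" "a \<noteq> b" "z \<sim> a" "z \<sim> b"
      and closed: "\<forall>u \<in> {z, a, b}. \<forall>v \<in> H. u \<sim> v \<longrightarrow> v \<in> {z, a, b}" by blast
    obtain e f g c t s where "distinct [e, f, g, c, t, s]" "H = {e, f, g, c, t, s}"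
      "e \<sim> f" "f \<sim> g" "y \<sim> e" "\<not> y \<sim> f" "\<not> y \<sim> g" "c \<sim> t" "t \<sim> s" "y \<sim> c" "\<not> y \<sim> t" "\<not> y \<sim> s"
      "\<forall>u \<in> {e, f, g}. \<forall>v \<in> {c, t, s}. \<not> u \<sim> v"
      using closed_triple[OF z] closed by blast
    then show ?thesis using iso_two_arms by blast
  next
    case 4
    then show ?thesis using tight_leaf_cyclic.iso_hexagon[OF 4] by blast
  qed
qed

section \<open>Values of the extremal graphs\<close>

lemma nonisolated_image:
  assumes "\<And>u v. \<lbrakk>u \<in> W; v \<in> W\<rbrakk> \<Longrightarrow> (f u, f v) \<in> parcs F \<longleftrightarrow> (u, v) \<in> parcs G"
  shows "nonisolated F (f ` W) = f ` nonisolated G W"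
  using assms by (auto simp: nonisolated_def)

text \<open>\<open>connected\<close> is defined through the symmetric closure, which adds no arcs
  here; induction along a walk then never leaves \<open>S\<close>.\<close>

lemma (in pair_graph) connected_closed_eq_verts:
  assumes "connected (with_proj G)" and S: "S \<subseteq> pverts G" "S \<noteq> {}"
    and closed: "\<And>u v. \<lbrakk>u \<in> S; (u, v) \<in> parcs G\<rbrakk> \<Longrightarrow> v \<in> S"
  shows "S = pverts G"
proof (rule equalityI[OF S(1)], rule subsetI)
  fix v assume v: "v \<in> pverts G"
  obtain u where u: "u \<in> S" using S(2) by blast
  let ?M = "with_proj (mk_symmetric (with_proj G))"
  have arcs: "(a, b) \<in> parcs (mk_symmetric (with_proj G)) \<Longrightarrow> (a, b) \<in> parcs G" for a b
    using adj_sym by (auto simp: parcs_mk_symmetric)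
  have "u \<rightarrow>\<^sup>*\<^bsub>?M\<^esub> v"
    using assms(1) u v S(1) unfolding connected_def strongly_connected_def by auto
  then have "(u, v) \<in> (parcs (mk_symmetric (with_proj G)))\<^sup>*"
    using reachable_rtranclI by fastforce
  then show "v \<in> S"
    by (induction rule: rtrancl_induct) (use u closed arcs in blast)+
qed

text \<open>A library isomorphism carries its own arc map; since tails and heads are
  \<open>fst\<close> and \<open>snd\<close> on both sides, this map is
  \<open>map_prod f f\<close>.\<close>

lemma digraph_isoE:
  assumes "digraph_iso (with_proj G) (with_proj F)"
  obtains f where "inj_on f (pverts G)" "pverts F = f ` pverts G" "parcs F = map_prod f f ` parcs G"
proof -
  obtain hom where hom: "pre_digraph.digraph_isomorphism (with_proj G) hom"
    "with_proj F = app_iso hom (with_proj G)"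
    using assms by (auto simp: digraph_iso_def)
  then have F: "pverts F = iso_verts hom ` pverts G" "parcs F = iso_arcs hom ` parcs G"
    "iso_tail hom = fst" "iso_head hom = snd"
    by (simp_all add: with_proj_def app_iso_def)
  have "iso_arcs hom a = map_prod (iso_verts hom) (iso_verts hom) a" if "a \<in> parcs G" for a
    using hom(1) that unfolding pre_digraph.digraph_isomorphism_def F(3,4)
    by (auto simp: prod_eq_iff)
  then have "parcs F = map_prod (iso_verts hom) (iso_verts hom) ` parcs G"
    unfolding F(2) by (rule image_cong[OF refl])
  then show thesis
    using that F(1) hom(1) by (auto simp: pre_digraph.digraph_isomorphism_def)
qed

text \<open>The vertex map carries unresolved sets and playable vertices of a position to those of
  its image, so the options of both players agree by induction on the number of unresolved
  vertices.\<close>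

lemma staller_isolation_number_iso:
  assumes "pair_graph G" and "pair_graph F" and "digraph_iso (with_proj G) (with_proj F)"
  shows "staller_isolation_number F = staller_isolation_number G"
proof -
  interpret G: pair_graph G by fact
  interpret F: pair_graph F by fact
  obtain f where f: "inj_on f (pverts G)" "pverts F = f ` pverts G" "parcs F = map_prod f f ` parcs G"
    using digraph_isoE[OF assms(3)] .
  have adj: "(f u, f v) \<in> parcs F \<longleftrightarrow> (u, v) \<in> parcs G" if "u \<in> pverts G" "v \<in> pverts G" for u v
    using that f(1) G.adj_verts unfolding f(3) by (auto dest!: inj_onD[OF f(1)])
  have nbhd: "closed_nbhd F (f ` X) = f ` closed_nbhd G X" if "X \<subseteq> pverts G" for X
    using that adj unfolding closed_nbhd_def f(2) by blast
  have nbhd_sub: "closed_nbhd G X \<subseteq> pverts G" if "X \<subseteq> pverts G" for X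
    using that by (auto simp: closed_nbhd_def)
  have unres: "unresolved F (f ` X) = f ` unresolved G X" if X: "X \<subseteq> pverts G" for X
  proof -
    have "pverts F - closed_nbhd F (f ` X) = f ` (pverts G - closed_nbhd G X)"
      unfolding nbhd[OF X] f(2) using f(1) nbhd_sub[OF X] by (simp add: inj_on_image_set_diff)
    then show ?thesis
      unfolding unresolved_def using nonisolated_image[of "pverts G - closed_nbhd G X" f F G] adj by simp
  qed
  have play: "playable F (f ` X) (f x) \<longleftrightarrow> playable G X x" if "X \<subseteq> pverts G" "x \<in> pverts G" for X x
  proof -
    have "f ` closed_nbhd G {x} \<inter> f ` unresolved G X = f ` (closed_nbhd G {x} \<inter> unresolved G X)"
      using inj_on_image_Int[OF f(1)] nbhd_sub[of "{x}"] G.unresolved_subset that by simp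
    then show ?thesis
      using nbhd[of "{x}"] that f(2) by (simp add: F.playable_iff G.playable_iff unres)
  qed
  have "remaining_moves F p (f ` X) = remaining_moves G p X" if "X \<subseteq> pverts G" for p X
    using that
  proof (induction "card (unresolved G X)" arbitrary: p X rule: less_induct)
    case less
    have "playable F (f ` X) z \<Longrightarrow> z \<in> f ` pverts G" "playable G X x \<Longrightarrow> x \<in> pverts G" for x z
      by (auto simp: F.playable_iff G.playable_iff f(2))
    then have moves: "{x. playable F (f ` X) x} = f ` {x. playable G X x}"
      using play[OF less.prems] by blast
    have step: "remaining_moves F q (insert (f x) (f ` X)) = remaining_moves G q (insert x X)"
      if "playable G X x" for q x
      using less.hyps[OF G.card_unresolved_insert_less[OF that], of q] less.prems that
      by (simp add: G.playable_iff)
    have images: "(\<lambda>x. remaining_moves F q (insert x (f ` X))) ` {x. playable F (f ` X) x}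
        = (\<lambda>x. remaining_moves G q (insert x X)) ` {x. playable G X x}" for q
      unfolding moves image_image using step by (intro image_cong) auto
    have "(\<exists>x. playable F (f ` X) x) \<longleftrightarrow> (\<exists>x. playable G X x)"
      using moves by blast
    then show ?case
      by (subst (1 2) remaining_moves.simps, cases p)
        (simp_all add: images F.pair_finite_verts G.pair_finite_verts)
  qed
  from this[of "{}" Staller] show ?thesis
    by (simp add: staller_isolation_number_def)
qed

section \<open>Lower bounds by evaluation\<close>

definition undominated :: "('a \<times> 'a) list \<Rightarrow> 'a list \<Rightarrow> 'a \<Rightarrow> bool" where
  "undominated es X p \<longleftrightarrow> p \<notin> set X \<and> (\<forall>a \<in> set X. (a, p) \<notin> set es)"

text \<open>An executable criterion for \<open>w\<close> being playable after the moves
  \<open>X\<close>; \<open>es\<close> is meant to list every edge in both directions.\<close>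

definition live :: "('a \<times> 'a) list \<Rightarrow> 'a list \<Rightarrow> 'a \<Rightarrow> bool" where
  "live es X w \<longleftrightarrow>
    (\<exists>(p, q) \<in> set es. undominated es X p \<and> undominated es X q \<and> (p = w \<or> (w, p) \<in> set es))"

text \<open>A certificate for four moves: whatever Dominator answers to \<open>x\<close>, Staller
  has a move after which the game is not over. Quantifying over all vertices \<open>z\<close> avoids
  a test of playability.\<close>

definition staller_prolongs :: "'a list \<Rightarrow> ('a \<times> 'a) list \<Rightarrow> 'a \<Rightarrow> bool" where
  "staller_prolongs vs es x \<longleftrightarrow>
    (\<forall>z \<in> set vs. \<exists>w \<in> set vs. live es [x, z] w \<and> (\<exists>(p, q) \<in> set es. live es [x, z, w] p))"

context pair_graph
begin

lemma unresolvedI: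
  assumes "parcs G = set es" "(p, q) \<in> set es" "undominated es X p" "undominated es X q"
  shows "p \<in> unresolved G (set X)"
  using assms adj_verts[of p q] by (auto simp: unresolved_def nonisolated_def undominated_def closed_nbhd_def)

lemma live_playable:
  assumes "parcs G = set es" "live es X w"
  shows "playable G (set X) w"
proof -
  obtain p q where pq: "(p, q) \<in> set es" "undominated es X p" "undominated es X q" "p = w \<or> (w, p) \<in> set es"
    using assms(2) by (auto simp: live_def)
  then show ?thesis
    using unresolvedI[OF assms(1) pq(1-3)] adj_verts[of p q] adj_verts[of w p] assms(1)
    by (auto simp: playable_iff closed_nbhd_single)
qed

lemma remaining_moves_pos: "playable G X x \<Longrightarrow> 1 \<le> remaining_moves G p X"
  by (subst remaining_moves.simps) (auto simp: pair_finite_verts)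

lemma two_moves:
  assumes "playable G {} x" and "playable G {x} z"
  shows "2 \<le> staller_isolation_number G"
  using remaining_moves_Staller_ge[OF assms(1)] remaining_moves_pos[OF assms(2), of Dominator]
  by (simp add: staller_isolation_number_def)

lemma four_moves:
  assumes es: "parcs G = set es" and vs: "pverts G = set vs" and x: "live es [] x" and "staller_prolongs vs es x"
  shows "4 \<le> staller_isolation_number G"
proof -
  have w: "\<exists>w. playable G {x, z} w \<and> (\<exists>p. playable G {x, z, w} p)" if z: "z \<in> pverts G" for z
  proof -
    obtain w p where "live es [x, z] w" "live es [x, z, w] p"
      using assms(4) z vs unfolding staller_prolongs_def by blast
    then show ?thesis
      using live_playable[OF es, of "[x, z]" w] live_playable[OF es, of "[x, z, w]" p] by auto
  qed
  have px: "playable G {} x" using live_playable[OF es x] by simp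
  then have "x \<in> pverts G" by (simp add: playable_def)
  \<comment> \<open>Taking \<open>z = x\<close> in the certificate shows that the game does not end
    with the opening.\<close>
  then have "\<exists>w. playable G {x} w" using w[of x] by auto
  then obtain z where z: "playable G {x} z"
    "remaining_moves G Dominator {x} = Suc (remaining_moves G Staller (insert z {x}))"
    using remaining_moves_Dominator_ex ex_playable_iff by metis
  obtain w p where wp: "playable G {x, z} w" "playable G {x, z, w} p"
    using w[of z] z(1) by (auto simp: playable_def)
  have "2 \<le> remaining_moves G Staller {x, z}"
    using remaining_moves_Staller_ge[OF wp(1)] remaining_moves_pos[of "insert w {x, z}" p Dominator] wp(2)
    by (simp add: insert_commute)
  then show ?thesis
    using remaining_moves_Staller_ge[OF px] z(2)
    by (simp add: staller_isolation_number_def insert_commute)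
qed

end

lemma pair_graph_graph_on:
  assumes "E \<subseteq> {1..n} \<times> {1..n}" and "\<And>i. (i, i) \<notin> E"
  shows "pair_graph (graph_on n E)"
proof -
  have "finite E" using assms(1) finite_subset by blast
  then show ?thesis
    using assms by unfold_locales (auto simp: graph_on_def symmetric_def sym_def)
qed

definition arcs_of :: "('a \<times> 'a) list \<Rightarrow> ('a \<times> 'a) list" where
  "arcs_of es = es @ map prod.swap es"

definition edges_upto :: "nat \<Rightarrow> (nat \<times> nat) list \<Rightarrow> bool" where
  "edges_upto n es \<longleftrightarrow> list_all (\<lambda>(i, j). 1 \<le> i \<and> i \<le> n \<and> 1 \<le> j \<and> j \<le> n \<and> i \<noteq> j) es"

lemma pair_graph_graph_on_edges:
  "edges_upto n es \<Longrightarrow> pair_graph (graph_on n (set es))"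
  by (rule pair_graph_graph_on) (auto simp: edges_upto_def list_all_iff)

lemma parcs_graph_on_edges: "parcs (graph_on n (set es)) = set (arcs_of es)"
  by (force simp: graph_on_def arcs_of_def)

lemma graph_on_two_moves:
  assumes "edges_upto n es" and "live (arcs_of es) [] x" and "live (arcs_of es) [x] z"
  shows "pair_graph (graph_on n (set es)) \<and> 2 \<le> staller_isolation_number (graph_on n (set es))"
proof -
  interpret pair_graph "graph_on n (set es)" using pair_graph_graph_on_edges[OF assms(1)] .
  show ?thesis
    using two_moves[of x z] live_playable[OF parcs_graph_on_edges assms(2)]
      live_playable[OF parcs_graph_on_edges assms(3)] pair_graph by simp
qed

lemma graph_on_four_moves:
  assumes "edges_upto n es" and "live (arcs_of es) [] x" and "staller_prolongs [1..<Suc n] (arcs_of es) x"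
  shows "pair_graph (graph_on n (set es)) \<and> 4 \<le> staller_isolation_number (graph_on n (set es))"
proof -
  interpret pair_graph "graph_on n (set es)" using pair_graph_graph_on_edges[OF assms(1)] .
  have "pverts (graph_on n (set es)) = set [1..<Suc n]" by (auto simp: graph_on_def)
  then show ?thesis
    using four_moves[OF parcs_graph_on_edges _ assms(2,3)] pair_graph by simp
qed

lemma F1_value: "pair_graph F1 \<and> 1 \<le> staller_isolation_number F1"
proof -
  have F1: "F1 = graph_on 2 (set [(1, 2)])" by (simp add: F1_def)
  have "edges_upto 2 [(1, 2)]" "live (arcs_of [(1, 2 :: nat)]) [] 1" by code_simp+
  then show ?thesis
    unfolding F1 staller_isolation_number_def
    using pair_graph_graph_on_edges pair_graph.remaining_moves_pos
      pair_graph.live_playable[OF _ parcs_graph_on_edges, of 2 "[(1, 2)]" "[]" 1] by fastforce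
qed

lemma F2_value: "pair_graph F2 \<and> 2 \<le> staller_isolation_number F2"
proof -
  have "F2 = graph_on 4 (set [(1, 2), (2, 3), (3, 4)])" by (simp add: F2_def)
  moreover have "edges_upto 4 [(1, 2), (2, 3), (3, 4)]"
    "live (arcs_of [(1, 2), (2, 3), (3, 4 :: nat)]) [] 1"
    "live (arcs_of [(1, 2), (2, 3), (3, 4 :: nat)]) [1] 3" by code_simp+
  ultimately show ?thesis using graph_on_two_moves by metis
qed

lemma F3_value: "pair_graph F3 \<and> 2 \<le> staller_isolation_number F3"
proof -
  have "F3 = graph_on 4 (set [(1, 2), (2, 3), (3, 1), (1, 4)])" by (simp add: F3_def)
  moreover have "edges_upto 4 [(1, 2), (2, 3), (3, 1), (1, 4)]"
    "live (arcs_of [(1, 2), (2, 3), (3, 1), (1, 4 :: nat)]) [] 4"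
    "live (arcs_of [(1, 2), (2, 3), (3, 1), (1, 4 :: nat)]) [4] 2" by code_simp+
  ultimately show ?thesis using graph_on_two_moves by metis
qed

text \<open>Staller opens on the extra leaf 8, and the certificate is evaluated over all answers of
  Dominator. The other graphs on eight vertices are treated alike, the hexagon graphs with the leaf
  7.\<close>

lemma F4_value: "pair_graph F4 \<and> 4 \<le> staller_isolation_number F4"
proof -
  let ?es = "[(1,2), (2,3), (3,4), (4,5), (5,6), (6,7), (4,8)] :: (nat \<times> nat) list"
  have "F4 = graph_on 8 (set ?es)" by (simp add: F4_def)
  moreover have "edges_upto 8 ?es" "live (arcs_of ?es) [] 8" "staller_prolongs [1..<Suc 8] (arcs_of ?es) 8"
    by code_simp+
  ultimately show ?thesis using graph_on_four_moves by metis
qed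

lemma F5_value: "pair_graph F5 \<and> 4 \<le> staller_isolation_number F5"
proof -
  let ?es = "[(1,2), (2,3), (3,1), (3,4), (4,5), (5,6), (6,7), (4,8)] :: (nat \<times> nat) list"
  have "F5 = graph_on 8 (set ?es)" by (simp add: F5_def)
  moreover have "edges_upto 8 ?es" "live (arcs_of ?es) [] 8" "staller_prolongs [1..<Suc 8] (arcs_of ?es) 8"
    by code_simp+
  ultimately show ?thesis using graph_on_four_moves by metis
qed

lemma F6_value: "pair_graph F6 \<and> 4 \<le> staller_isolation_number F6"
proof -
  let ?es = "[(1,2), (2,3), (3,1), (5,6), (6,7), (7,5), (4,3), (4,5), (4,8)] :: (nat \<times> nat) list"
  have "F6 = graph_on 8 (set ?es)" by (simp add: F6_def)
  moreover have "edges_upto 8 ?es" "live (arcs_of ?es) [] 8" "staller_prolongs [1..<Suc 8] (arcs_of ?es) 8"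
    by code_simp+
  ultimately show ?thesis using graph_on_four_moves by metis
qed

definition hexagon_edges :: "nat list \<Rightarrow> (nat \<times> nat) list" where
  "hexagon_edges js = [(1,2), (2,3), (3,4), (4,5), (5,6), (6,1), (7,8)] @ map (Pair 8) js"

lemma hexagon_graph_four_moves:
  assumes "edges_upto 8 (hexagon_edges js)" and "live (arcs_of (hexagon_edges js)) [] 7"
    and "staller_prolongs [1..<Suc 8] (arcs_of (hexagon_edges js)) 7"
  shows "pair_graph (hexagon_graph (set js)) \<and> 4 \<le> staller_isolation_number (hexagon_graph (set js))"
proof -
  have "hexagon_graph (set js) = graph_on 8 (set (hexagon_edges js))"
    unfolding hexagon_graph_def by (rule arg_cong[of _ _ "graph_on 8"]) (auto simp: hexagon_edges_def)
  then show ?thesis using graph_on_four_moves[OF assms] by simp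
qed

lemma F7_value: "pair_graph F7 \<and> 4 \<le> staller_isolation_number F7"
  unfolding F7_def by (rule hexagon_graph_four_moves[of "[1]", simplified list.set]) code_simp+

lemma F8_value: "pair_graph F8 \<and> 4 \<le> staller_isolation_number F8"
  unfolding F8_def by (rule hexagon_graph_four_moves[of "[1, 2]", simplified list.set]) code_simp+

lemma F9_value: "pair_graph F9 \<and> 4 \<le> staller_isolation_number F9"
  unfolding F9_def by (rule hexagon_graph_four_moves[of "[1, 3]", simplified list.set]) code_simp+

lemma F10_value: "pair_graph F10 \<and> 4 \<le> staller_isolation_number F10"
  unfolding F10_def by (rule hexagon_graph_four_moves[of "[1, 4]", simplified list.set]) code_simp+

lemma F11_value: "pair_graph F11 \<and> 4 \<le> staller_isolation_number F11"
  unfolding F11_def by (rule hexagon_graph_four_moves[of "[6, 1, 2]", simplified list.set]) code_simp+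

lemma extremal_value:
  assumes "F \<in> {F1, F2, F3, F4, F5, F6, F7, F8, F9, F10, F11}"
  shows "pair_graph F \<and> card (pverts F) \<le> 2 * staller_isolation_number F"
proof -
  have card: "card (pverts (graph_on n E)) = n" for n E by (simp add: graph_on_def)
  have "card (pverts F1) = 2" "card (pverts F2) = 4" "card (pverts F3) = 4" "card (pverts F4) = 8"
    "card (pverts F5) = 8" "card (pverts F6) = 8"
    by (simp_all add: F1_def F2_def F3_def F4_def F5_def F6_def card)
  moreover have "card (pverts (hexagon_graph J)) = 8" for J
    by (simp add: hexagon_graph_def card)
  ultimately show ?thesis
    using assms F1_value F2_value F3_value F4_value F5_value F6_value F7_value F8_value F9_value
      F10_value F11_value
    unfolding F7_def F8_def F9_def F10_def F11_def by fastforce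
qed

section \<open>The upper bound and its equality case\<close>

context pair_graph
begin

lemma unresolved_empty:
  assumes "connected (with_proj G)" and "2 \<le> card (pverts G)"
  shows "unresolved G {} = pverts G"
proof -
  have "\<exists>u. v \<sim> u" if "v \<in> pverts G" for v
  proof (rule ccontr)
    assume "\<not> ?thesis"
    then have "{v} = pverts G"
      using connected_closed_eq_verts[OF assms(1), of "{v}"] that by blast
    then have "card (pverts G) = 1" by (metis is_singletonI is_singleton_altdef)
    then show False using assms(2) by simp
  qed
  then show ?thesis
    using adj_verts by (simp add: unresolved_def nonisolated_def closed_nbhd_def) blast
qed

text \<open>If a connected graph has a playable vertex, all its vertices are unresolved at the
  start. So the opening resolves its whole closed neighborhood, at least two vertices, which pays
  for the move.\<close>

lemma first_move:
  assumes "connected (with_proj G)" and x: "playable G {} x"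
  shows "2 \<le> card (closed_nbhd G {x})"
    and "card (unresolved G {x}) + card (closed_nbhd G {x}) \<le> card (pverts G)"
    and "unresolved G {x} \<subseteq> pverts G - closed_nbhd G {x}"
proof -
  have xV: "x \<in> pverts G" and "unresolved G {} \<noteq> {}" using x by (auto simp: playable_iff)
  then obtain v u where "v \<in> pverts G" "v \<sim> u"
    by (auto simp: unresolved_def nonisolated_def)
  then have "{v, u} \<subseteq> pverts G" "card {v, u} = 2" using adj_verts[of v u] adj_neq[of v u] by auto
  then have "2 \<le> card (pverts G)" using card_mono[OF pair_finite_verts] by metis
  then have U: "unresolved G {} = pverts G" using unresolved_empty[OF assms(1)] by blast
  then obtain w where w: "x \<sim> w" using unresolved_nbr[of x "{}"] xV by auto
  have sub: "closed_nbhd G {x} \<subseteq> pverts G" using xV by (auto simp: closed_nbhd_def)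
  have "card {x, w} \<le> card (closed_nbhd G {x})"
    using w finite_subset[OF sub pair_finite_verts] by (intro card_mono) (auto simp: closed_nbhd_single)
  then show "2 \<le> card (closed_nbhd G {x})" using adj_neq[OF w] by simp
  show *: "unresolved G {x} \<subseteq> pverts G - closed_nbhd G {x}"
    using unresolved_insert_subset[of x "{}"] U by simp
  show "card (unresolved G {x}) + card (closed_nbhd G {x}) \<le> card (pverts G)"
    using card_le_minus[OF * sub pair_finite_verts] .
qed

theorem staller_isolation_number_le:
  assumes "connected (with_proj G)"
  shows "2 * staller_isolation_number G \<le> card (pverts G)"
proof (cases "unresolved G {} = {}")
  case True
  then show ?thesis by (simp add: staller_isolation_number_def remaining_moves_end)
next
  case False
  then obtain x where x: "playable G {} x"
    "remaining_moves G Staller {} = Suc (remaining_moves G Dominator {x})"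
    using remaining_moves_Staller_ex by blast
  then show ?thesis
    using first_move(1,2)[OF assms x(1)] remaining_moves_bounds[of "{x}"]
    by (simp add: staller_isolation_number_def)
qed

text \<open>Equality forces the opening \<open>x\<close> to dominate just one further vertex
  \<open>y\<close>, to resolve nothing else and to leave Dominator a tight position: this is the
  situation of \<open>tight_leaf\<close>.\<close>

theorem staller_isolation_number_eq:
  assumes conn: "connected (with_proj G)" and eq: "2 * staller_isolation_number G = card (pverts G)"
  shows "\<exists>F \<in> {F1, F2, F3, F4, F5, F6, F7, F8, F9, F10, F11}. digraph_iso (with_proj G) (with_proj F)"
proof -
  \<comment> \<open>Connectedness excludes the empty graph, where the equality would read 0 = 0
    without any opening move.\<close>
  have "pverts G \<noteq> {}"
    using conn by (auto simp: connected_def strongly_connected_def)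
  then have "unresolved G {} \<noteq> {}"
    using eq pair_finite_verts remaining_moves_end[of "{}" Staller]
    by (auto simp: staller_isolation_number_def)
  then obtain x where x: "playable G {} x"
    "remaining_moves G Staller {} = Suc (remaining_moves G Dominator {x})"
    using remaining_moves_Staller_ex by blast
  note first = first_move[OF conn x(1)]
  let ?H = "unresolved G {x}" and ?N = "closed_nbhd G {x}"
  have card: "card ?N = 2" "2 * remaining_moves G Dominator {x} = card ?H" "card ?H + 2 = card (pverts G)"
    using eq x(2) first(1,2) remaining_moves_bounds[of "{x}"]
    by (auto simp: staller_isolation_number_def)
  have xV: "x \<in> pverts G" using x(1) by (simp add: playable_def)
  have sub: "?N \<subseteq> pverts G" using xV by (auto simp: closed_nbhd_def)
  have xN: "x \<in> ?N" by (simp add: closed_nbhd_def)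
  then have "card (?N - {x}) = 1" using card(1) by simp
  then obtain y where "?N - {x} = {y}" by (rule card_1_singletonE)
  then have y: "?N = {x, y}" "x \<noteq> y" using xN by blast+
  have H: "?H = pverts G - {x, y}"
    using first(3) card(3) sub y pair_finite_verts by (intro card_subset_eq) (auto simp: card_Diff_subset)
  have x_adj: "x \<sim> v \<longleftrightarrow> v = y" for v
    using y adj_neq[of x v] by (auto simp: closed_nbhd_single)
  interpret tight_leaf G x y ?H
  proof unfold_locales
    show "pverts G = insert x (insert y ?H)" using H sub y by auto
    show "x \<notin> ?H" "y \<notin> ?H" using H by auto
    show "x \<sim> v \<longleftrightarrow> v = y" for v by (rule x_adj)
    show "D_tight ?H" using card(2) by (auto simp: D_tight_def)
    \<comment> \<open>A set closed in \<open>H\<close> and without neighbors of \<open>y\<close>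
      would be closed in all of \<open>G\<close>, as \<open>x\<close> is adjacent to
      \<open>y\<close> only.\<close>
    show "\<exists>b \<in> S. y \<sim> b"
      if S: "S \<subseteq> ?H" "S \<noteq> {}" "\<And>u v. \<lbrakk>u \<in> S; v \<in> ?H; u \<sim> v\<rbrakk> \<Longrightarrow> v \<in> S" for S
    proof (rule ccontr)
      assume no: "\<not> ?thesis"
      have "v \<in> S" if uv: "u \<in> S" "u \<sim> v" for u v
      proof -
        have vu: "v \<sim> u" using uv(2) by (rule adj_sym)
        then have "v \<noteq> y" using no uv(1) by blast
        moreover have "v \<noteq> x" using vu x_adj[of u] uv(1) S(1) H by auto
        ultimately have "v \<in> ?H" using H adj_verts[OF uv(2)] by simp
        then show ?thesis using S(3) uv by blast
      qed
      then have "S = pverts G"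
        using connected_closed_eq_verts[OF conn, of S] S(1,2) H by blast
      then show False using S(1) H xV by blast
    qed
  qed
  show ?thesis by (rule classification)
qed

end

theorem theorem3p2:
  fixes G :: "'a pair_pre_digraph" and n :: nat
  assumes "pair_graph G"
    and "connected (with_proj G)"
    and "card (pverts G) = n"
  shows "real (staller_isolation_number G) \<le> 1 / 2 * real n
    \<and> (real (staller_isolation_number G) = 1 / 2 * real n
        \<longleftrightarrow> (\<exists>F \<in> {F1, F2, F3, F4, F5, F6, F7, F8, F9, F10, F11}.
               digraph_iso (with_proj G) (with_proj F)))"
proof -
  interpret pair_graph G by fact
  have le: "2 * staller_isolation_number G \<le> n"
    using staller_isolation_number_le assms(2,3) by simp
  \<comment> \<open>Order and game value are invariant under isomorphism, so the lower bounds for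
    the listed graphs carry over to \<open>G\<close>.\<close>
  have "n \<le> 2 * staller_isolation_number G"
    if F: "F \<in> {F1, F2, F3, F4, F5, F6, F7, F8, F9, F10, F11}"
      and iso: "digraph_iso (with_proj G) (with_proj F)" for F
  proof -
    obtain f where "inj_on f (pverts G)" "pverts F = f ` pverts G" "parcs F = map_prod f f ` parcs G"
      using digraph_isoE[OF iso] .
    then have "card (pverts F) = n" using card_image assms(3) by metis
    then show ?thesis
      using extremal_value[OF F] staller_isolation_number_iso[OF assms(1) _ iso] by simp
  qed
  then have ge: "n \<le> 2 * staller_isolation_number G"
    if "\<exists>F \<in> {F1, F2, F3, F4, F5, F6, F7, F8, F9, F10, F11}. digraph_iso (with_proj G) (with_proj F)"
    using that by (elim bexE)
  have "2 * staller_isolation_number G = n \<longleftrightarrow>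
      (\<exists>F \<in> {F1, F2, F3, F4, F5, F6, F7, F8, F9, F10, F11}. digraph_iso (with_proj G) (with_proj F))"
    using le_antisym[OF le ge] staller_isolation_number_eq[OF assms(2)] assms(3) by argo
  moreover have "real (staller_isolation_number G) = 1 / 2 * real n \<longleftrightarrow> 2 * staller_isolation_number G = n"
    by auto
  ultimately show ?thesis using le by simp
qed

end
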